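(* A function from the pairs of a finite linear order into the nonnegative integers satisfies condition (!) if and only if it is equivalent to the signature of some element of $\mathcal{S}$; i.e. the class of (equivalence classes of) functions satisfying (!) is exactly the set of signatures of elements of $\mathcal{S}$. Moreover, if $A\in\mathcal{S}$, then the signature of the rotation $A^\circ$ is (equivalent to) the rotation of the signature of $A$.
   Context: Standard generating sets: $\mathrm{Homeo}_+(I)$ acts on $I=[0,1]$ on the right, composition left to right. Support $\mathrm{supt}(f)=\{t:tf\ne t\}$; extended support = interior of its closure; orbitals = components of the support, endpoints = transition points; a bump has exactly one orbital, positive if $tf>t$ there, else negative; the bump of $g$ on an orbital $J$ agrees with $g$ on $J$, identity elsewhere. A marking assigns to each bump $a$ with support $(u,v)$ a point $s_a\in(u,v)$; feet of $a$: $(u,s_a)$ and $[t_a,v)$ with $t_a=s_aa$ ($a$ positive) or $s_aa^{-1}$ ($a$ negative). A marked function has finitely many bumps, each marked. A finite set of marked functions is fast if no bump occurs in two of its elements and distinct bumps have disjoint feet. A standard function is a marked function whose extended support is an interval, with all positive bumps right of all negative bumps, and #positive $-$ #negative bumps $\in\{0,1\}$. For standard $f,g$: $f\ll g$ iff extended supports disjoint with $f$'s to the left; $f\sqsubset g$ iff closure of extended support of $f$ lies in extended support of $g$; $f<g$ iff $f\ll g$ or $f\sqsubset g$. $f^\circ$: if $f$ has $>2$ orbitals, $f$ restricted to the union of its non-extreme orbitals (identity elsewhere, markers inherited); if $f$ has 1 or 2 orbitals and the left foot of its positive bump is $(r,s)$, a positive bump with support $(r,s)$. $(f,g)$ is a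 standard pair if $\{f,g\}$ is fast and either $f\ll g$ or ($f\sqsubset g$ and $(g^\circ,f)$ is a standard pair). $\mathcal{S}$ = finite sets of standard functions, pairwise $<$-comparable, each pair $f<g$ a standard pair; elements $a_0<\dots<a_{n-1}$, greatest $a_{\max}$. Oscillation $o(f,g)$ for $f<g$: number of orbitals of $g$ containing a transition point of $f$. Signature of $A\in\mathcal S$: the function $(f,g)\mapsto o(f,g)$ on pairs $f<g$ of $A$; functions on pairs of finite linear orders are equivalent if an order-preserving bijection of bases carries one to the other. Rotation of $A\in\mathcal S$: $A^\circ=(A\setminus\{a_{\max}\})\cup\{a_{\max}^\circ\}$ if some $i<|A|-1$ has $o(a_i,a_{\max})>0$, else $A^\circ=A\setminus\{a_{\max}\}$ (ordered by $<$). Condition (!): write $r=p\,!\,q$ if $r\ge\min(p-1,q)$ with equality unless $p=q$; a function $\mathsf{A}$ on pairs of a finite linear order satisfies (!) if $\mathsf{A}(a,b)=\mathsf{A}(b,c)\,!\,\mathsf{A}(a,c)$ whenever $a<b<c$. For such $\mathsf{B},\mathsf{C}$, $\mathsf{B}+\mathsf{C}$ has base $B$ followed by $C$, agrees with $\mathsf{B}$, $\mathsf{C}$ on their bases and is $0$ across; $\mathsf{A}$ is indecomposable if it is not $\mathsf{B}+\mathsf{C}$ with both bases nonempty. Rotation of such a function: if the base is empty or a singleton, the rotation has empty base; if $\mathsf{A}=\mathsf{B}+\mathsf{C}$ with nonempty bases, $\mathsf{A}^\circ=\mathsf{B}+\mathsf{C}^\circ$; if $\mathsf{A}$ is indecomposable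 with base $\{0,\dots,n\}$, $n>0$, then $\mathsf{A}^\circ$ has base $\{-1,0,\dots,n-1\}$ (with $-1$ least), $\mathsf{A}^\circ(-1,i)=\mathsf{A}(i,n)-1$ for $0\le i<n$, and $\mathsf{A}^\circ(i,j)=\mathsf{A}(i,j)$ for $0\le i<j<n$. *)

theory Defs
  imports "HOL-Analysis.Analysis"
begin

section \<open>Homeomorphisms of I = [0,1] (right action: t f is written f t)\<close>

definition homeo_plus :: "(real \<Rightarrow> real) \<Rightarrow> bool" where
  "homeo_plus f \<longleftrightarrow> continuous_on {0..1} f \<and> strict_mono_on {0..1} f
      \<and> f ` {0..1} = {0..1} \<and> (\<forall>t. t \<notin> {0..1} \<longrightarrow> f t = t)"

definition supt :: "(real \<Rightarrow> real) \<Rightarrow> real set" where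
  "supt f = {t \<in> {0..1}. f t \<noteq> t}"

definition ext_supt :: "(real \<Rightarrow> real) \<Rightarrow> real set" where
  "ext_supt f = interior (closure (supt f))"

definition orbitals :: "(real \<Rightarrow> real) \<Rightarrow> real set set" where
  "orbitals f = {connected_component_set (supt f) t | t. t \<in> supt f}"

definition trans_pts :: "(real \<Rightarrow> real) \<Rightarrow> real set" where
  "trans_pts f = {Inf J | J. J \<in> orbitals f} \<union> {Sup J | J. J \<in> orbitals f}"

definition is_bump :: "(real \<Rightarrow> real) \<Rightarrow> bool" where
  "is_bump f \<longleftrightarrow> homeo_plus f \<and> card (orbitals f) = 1"

definition pos_orbital :: "(real \<Rightarrow> real) \<Rightarrow> real set \<Rightarrow> bool" where
  "pos_orbital f J \<longleftrightarrow> J \<in> orbitals f \<and> (\<forall>t\<in>J. f t > t)"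

definition neg_orbital :: "(real \<Rightarrow> real) \<Rightarrow> real set \<Rightarrow> bool" where
  "neg_orbital f J \<longleftrightarrow> J \<in> orbitals f \<and> (\<forall>t\<in>J. f t < t)"

definition bump_on :: "(real \<Rightarrow> real) \<Rightarrow> real set \<Rightarrow> (real \<Rightarrow> real)" where
  "bump_on g J = (\<lambda>t. if t \<in> J then g t else t)"

text \<open>A marked function is represented as a pair (f, M): M is the set of markers,
  containing exactly one point of every orbital of f.  A marked bump is a pair (b, s)
  of a bump b and its marker s.\<close>

type_synonym mfun = "(real \<Rightarrow> real) \<times> real set"

definition marked :: "mfun \<Rightarrow> bool" where
  "marked fM \<longleftrightarrow> homeo_plus (fst fM) \<and> finite (orbitals (fst fM)) \<and> snd fM \<subseteq> supt (fst fM)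
      \<and> (\<forall>J\<in>orbitals (fst fM). \<exists>!s. s \<in> snd fM \<and> s \<in> J)"

definition mbumps :: "mfun \<Rightarrow> ((real \<Rightarrow> real) \<times> real) set" where
  "mbumps fM = {(bump_on (fst fM) J, s) | J s. J \<in> orbitals (fst fM) \<and> s \<in> snd fM \<and> s \<in> J}"

definition left_foot :: "(real \<Rightarrow> real) \<times> real \<Rightarrow> real set" where
  "left_foot a = {Inf (supt (fst a))<..<snd a}"

definition right_foot :: "(real \<Rightarrow> real) \<times> real \<Rightarrow> real set" where
  "right_foot a =
     {(if (\<forall>t\<in>supt (fst a). fst a t > t) then fst a (snd a)
       else the_inv_into {0..1} (fst a) (snd a)) ..< Sup (supt (fst a))}"

definition feet :: "(real \<Rightarrow> real) \<times> real \<Rightarrow> real set" where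
  "feet a = left_foot a \<union> right_foot a"

definition fast :: "mfun set \<Rightarrow> bool" where
  "fast F \<longleftrightarrow> finite F \<and> (\<forall>x\<in>F. marked x)
     \<and> (\<forall>x\<in>F. \<forall>y\<in>F. x \<noteq> y \<longrightarrow> fst ` mbumps x \<inter> fst ` mbumps y = {})
     \<and> (\<forall>a\<in>\<Union>(mbumps ` F). \<forall>b\<in>\<Union>(mbumps ` F). a \<noteq> b \<longrightarrow> feet a \<inter> feet b = {})"

definition standard :: "mfun \<Rightarrow> bool" where
  "standard fM \<longleftrightarrow> marked fM
     \<and> (\<exists>a b. a < b \<and> ext_supt (fst fM) = {a<..<b})
     \<and> (\<forall>P N x y. pos_orbital (fst fM) P \<longrightarrow> neg_orbital (fst fM) N \<longrightarrow> x \<in> N \<longrightarrow> y \<in> P \<longrightarrow> x < y)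
     \<and> (card {J. pos_orbital (fst fM) J} = card {J. neg_orbital (fst fM) J}
        \<or> card {J. pos_orbital (fst fM) J} = card {J. neg_orbital (fst fM) J} + 1)"

definition std_ll :: "mfun \<Rightarrow> mfun \<Rightarrow> bool" where
  "std_ll f g \<longleftrightarrow> (\<forall>x\<in>ext_supt (fst f). \<forall>y\<in>ext_supt (fst g). x < y)"

definition std_sq :: "mfun \<Rightarrow> mfun \<Rightarrow> bool" where
  "std_sq f g \<longleftrightarrow> closure (ext_supt (fst f)) \<subseteq> ext_supt (fst g)"

definition std_lt :: "mfun \<Rightarrow> mfun \<Rightarrow> bool" where
  "std_lt f g \<longleftrightarrow> std_ll f g \<or> std_sq f g"

text \<open>circ f h : h is (a possible value of) f-circ.  For more than two orbitals f-circ is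
  determined; for one or two orbitals it is *a* marked positive bump whose support is the
  left foot of the positive bump of f (any such bump / marker).\<close>
definition circ :: "mfun \<Rightarrow> mfun \<Rightarrow> bool" where
  "circ f h \<longleftrightarrow>
     (card (orbitals (fst f)) > 2 \<and>
        (let U = \<Union>{J \<in> orbitals (fst f). \<exists>J1\<in>orbitals (fst f). \<exists>J2\<in>orbitals (fst f).
                       (\<forall>x\<in>J1. \<forall>y\<in>J. x < y) \<and> (\<forall>x\<in>J. \<forall>y\<in>J2. x < y)}
         in h = ((\<lambda>t. if t \<in> U then fst f t else t), snd f \<inter> U)))
   \<or> (card (orbitals (fst f)) \<in> {1, 2} \<and>
        (\<exists>J s. pos_orbital (fst f) J \<and> s \<in> snd f \<and> s \<in> J \<and>
           (\<exists>b s'. h = (b, {s'}) \<and> homeo_plus b \<and> supt b = {Inf J<..<s}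
              \<and> (\<forall>t\<in>supt b. b t > t) \<and> s' \<in> {Inf J<..<s})))"

inductive std_pair :: "mfun \<Rightarrow> mfun \<Rightarrow> bool" where
  ll: "fast {f, g} \<Longrightarrow> std_ll f g \<Longrightarrow> std_pair f g"
| sq: "fast {f, g} \<Longrightarrow> std_sq f g \<Longrightarrow> circ g h \<Longrightarrow> std_pair h f \<Longrightarrow> std_pair f g"

definition std_sets :: "mfun set set" ("\<S>") where
  "\<S> = {A. finite A \<and> (\<forall>f\<in>A. standard f)
        \<and> (\<forall>f\<in>A. \<forall>g\<in>A. f \<noteq> g \<longrightarrow> std_lt f g \<or> std_lt g f)
        \<and> (\<forall>f\<in>A. \<forall>g\<in>A. std_lt f g \<longrightarrow> std_pair f g)}"

definition osc :: "mfun \<Rightarrow> mfun \<Rightarrow> int" where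
  "osc f g = int (card {J \<in> orbitals (fst g). \<exists>t\<in>trans_pts (fst f). t \<in> J})"

text \<open>rotation of A (relation, because of the choice in f-circ)\<close>
definition set_rotation :: "mfun set \<Rightarrow> mfun set \<Rightarrow> bool" where
  "set_rotation A A' \<longleftrightarrow> (\<exists>m\<in>A. (\<forall>a\<in>A - {m}. std_lt a m) \<and>
      (if (\<exists>a\<in>A - {m}. osc a m > 0)
       then (\<exists>h. circ m h \<and> A' = (A - {m}) \<union> {h})
       else A' = A - {m}))"

text \<open>A function on pairs of a finite linear order (B, lt) is F, evaluated at (a,b) with lt a b.\<close>
definition pf_equiv :: "'a set \<Rightarrow> ('a \<Rightarrow> 'a \<Rightarrow> bool) \<Rightarrow> ('a \<Rightarrow> 'a \<Rightarrow> int)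
                       \<Rightarrow> 'b set \<Rightarrow> ('b \<Rightarrow> 'b \<Rightarrow> bool) \<Rightarrow> ('b \<Rightarrow> 'b \<Rightarrow> int) \<Rightarrow> bool" where
  "pf_equiv B1 lt1 F1 B2 lt2 F2 \<longleftrightarrow> (\<exists>h. bij_betw h B1 B2
      \<and> (\<forall>a\<in>B1. \<forall>b\<in>B1. lt1 a b \<longleftrightarrow> lt2 (h a) (h b))
      \<and> (\<forall>a\<in>B1. \<forall>b\<in>B1. lt1 a b \<longrightarrow> F2 (h a) (h b) = F1 a b))"

definition bang :: "int \<Rightarrow> int \<Rightarrow> int \<Rightarrow> bool" where
  "bang r p q \<longleftrightarrow> r \<ge> min (p - 1) q \<and> (p \<noteq> q \<longrightarrow> r = min (p - 1) q)"

definition bang_cond :: "'a set \<Rightarrow> ('a \<Rightarrow> 'a \<Rightarrow> bool) \<Rightarrow> ('a \<Rightarrow> 'a \<Rightarrow> int) \<Rightarrow> bool" where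
  "bang_cond B lt F \<longleftrightarrow> (\<forall>a\<in>B. \<forall>b\<in>B. \<forall>c\<in>B. lt a b \<and> lt b c \<longrightarrow> bang (F a b) (F b c) (F a c))"

text \<open>Canonical representatives: base {0..<n} with the usual order.\<close>
type_synonym cpf = "nat \<times> (nat \<Rightarrow> nat \<Rightarrow> int)"

definition pf_plus :: "cpf \<Rightarrow> cpf \<Rightarrow> cpf" where
  "pf_plus X Y = (fst X + fst Y, (\<lambda>i j. if j < fst X then snd X i j
       else if fst X \<le> i then snd Y (i - fst X) (j - fst X) else 0))"

definition pf_splits :: "cpf \<Rightarrow> nat \<Rightarrow> bool" where
  "pf_splits X k \<longleftrightarrow> 0 < k \<and> k < fst X \<and> (\<forall>i j. i < k \<and> k \<le> j \<and> j < fst X \<longrightarrow> snd X i j = 0)"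

text \<open>rotation of an indecomposable function with base {0..N}: the new base {-1,0,..,N-1}
  is relabelled by x \<mapsto> x+1\<close>
definition pf_rot_indec :: "cpf \<Rightarrow> cpf" where
  "pf_rot_indec X = (if fst X \<le> 1 then (0, \<lambda>_ _. 0)
     else (fst X, (\<lambda>i j. if i = 0 then snd X (j - 1) (fst X - 1) - 1 else snd X (i - 1) (j - 1))))"

definition pf_rot :: "cpf \<Rightarrow> cpf" where
  "pf_rot X = (if fst X \<le> 1 then (0, \<lambda>_ _. 0)
     else if (\<exists>k. pf_splits X k)
     then (let k = (GREATEST k. pf_splits X k)
           in pf_plus (k, snd X) (pf_rot_indec (fst X - k, \<lambda>i j. snd X (i + k) (j + k))))
     else pf_rot_indec X)"

end

theory Submission
  imports Defs
begin

text \<open>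
  A standard function is recorded by its frame: its breakpoints, the markers and their images.
  Fastness, the relations \<open>f \<lless> g\<close> and \<open>f \<sqsubset> g\<close>, oscillation and \<open>f\<^sup>\<circ>\<close> only depend
  on frames.  Since feet are disjoint, every breakpoint of \<open>f \<sqsubset> g\<close> lies inside an orbital of \<open>g\<close>, and
  comparing \<open>(f, g)\<close> with \<open>(g\<^sup>\<circ>, f)\<close> gives \<open>o(f, g) = o(g\<^sup>\<circ>, f) + 1\<close>, which is the claim on rotations.
  Condition (!) for \<open>a < b < c\<close> is equivalent to (!) for \<open>c\<^sup>\<circ> < a < b\<close>, so it follows by induction on the
  number of orbitals.  Conversely, a function satisfying (!) either splits as a sum, or its rotation
  satisfies (!) and has smaller total value; a realization of the rotation is turned into one of the
  function by adding to its least element one bump at either end, with tiny feet near the old support.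
\<close>

section \<open>Frames of standard functions\<close>

text \<open>The definition of \<open>circ\<close> leaves the marker of a new bump free, so nothing
  may depend on it. Such a bump has both feet inside one left foot of the old function, hence meets
  no foot of a function that is fast with the old one, and only its support enters into
  oscillations. The rotation identity has the following source. If g is rotated to a function nested
  in f, then the ends of f lie in the two extreme orbitals of g and account for 2; all other
  orbitals of g survive its rotation, and all other breakpoints of f survive that of f. So the
  oscillation of (f, g) is 2 plus that of the pair of rotated functions, and the identity for the
  pair (rotated g, f) turns this into 1 plus the oscillation of that pair. In the converse, adding
  outer bumps to X gives a function E whose rotation is X again, so each pair (X, Y) becomes a pair
  (Y, E) with oscillation one larger, while pairs not involving X stay untouched. The danger is a
  foot of some Y ending exactly at an end of X; therefore all frames of a configuration are kept
  free of common points.\<close>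

text \<open>Bump \<open>a\<close> number \<open>i < nb\<close> has support \<open>(bp i, bp (i + 1))\<close>, marker \<open>mk i = s\<^sub>a\<close> and
  \<open>im i = t\<^sub>a\<close>, so that its feet do not depend on its sign.  Values at larger indices are junk.\<close>

datatype frame = Frame (nb: nat) (bp: "nat \<Rightarrow> real") (mk: "nat \<Rightarrow> real") (im: "nat \<Rightarrow> real")

definition valid :: "frame \<Rightarrow> bool" where
  "valid A \<longleftrightarrow> 0 < nb A \<and> (\<forall>i<nb A. bp A i < mk A i \<and> mk A i < im A i \<and> im A i < bp A (Suc i))"

definition foot :: "frame \<Rightarrow> nat \<Rightarrow> real set" where
  "foot A i = {bp A i<..<mk A i} \<union> {im A i..<bp A (Suc i)}"

abbreviation cell :: "frame \<Rightarrow> nat \<Rightarrow> real set" where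
  "cell A i \<equiv> {bp A i<..<bp A (Suc i)}"

definition feet_disjoint :: "frame \<Rightarrow> frame \<Rightarrow> bool" where
  "feet_disjoint A B \<longleftrightarrow> (\<forall>i<nb A. \<forall>j<nb B. foot A i \<inter> foot B j = {})"

text \<open>Being standard forces exactly the first \<open>nb div 2\<close> bumps to be negative.\<close>

definition has_frame :: "mfun \<Rightarrow> frame \<Rightarrow> bool" where
  "has_frame f A \<longleftrightarrow> valid A \<and> homeo_plus (fst f) \<and> supt (fst f) = (\<Union>i<nb A. cell A i)
     \<and> snd f = mk A ` {..<nb A}
     \<and> (\<forall>i<nb A. if i < nb A div 2
          then (\<forall>r\<in>cell A i. fst f r < r) \<and> fst f (im A i) = mk A i
          else (\<forall>r\<in>cell A i. fst f r > r) \<and> fst f (mk A i) = im A i)"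

section \<open>Order of breakpoints and cells\<close>

lemma validD:
  assumes "valid A" "i < nb A"
  shows "bp A i < mk A i" "mk A i < im A i" "im A i < bp A (Suc i)" "bp A i < bp A (Suc i)"
  using assms unfolding valid_def by force+

lemma bp_less: "bp A i < bp A j" if "valid A" "i < j" "j \<le> nb A"
  using that(2,3)
proof (induction j)
  case (Suc j)
  have "bp A j < bp A (Suc j)" using validD(4)[OF that(1)] Suc by simp
  then show ?case using Suc by (cases "i = j") auto
qed simp

lemma bp_le: "bp A i \<le> bp A j" if "valid A" "i \<le> j" "j \<le> nb A"
  using bp_less[OF that(1)] that(2,3) by (cases "i = j") (auto simp: le_less)

lemma bp_less_iff: "bp A i < bp A j \<longleftrightarrow> i < j" if "valid A" "i \<le> nb A" "j \<le> nb A"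
  using bp_less[OF that(1)] bp_le[OF that(1)] that(2,3) by (meson not_less)

lemma bp_notin_cell: "bp A j \<notin> cell A i" if "valid A" "i < nb A" "j \<le> nb A"
  using that by (auto simp: bp_less_iff)

lemma cell_disjoint: "cell A i \<inter> cell A j = {}" if "valid A" "i < nb A" "j < nb A" "i \<noteq> j"
proof -
  have "Suc i \<le> j \<or> Suc j \<le> i" using that by auto
  then show ?thesis
    using bp_le[OF that(1), of "Suc i" j] bp_le[OF that(1), of "Suc j" i] that(2,3) by auto
qed

lemma foot_subset: "foot A i \<subseteq> cell A i" if "valid A" "i < nb A"
  using validD[OF that] by (auto simp: foot_def)

lemma inj_cell: "inj_on (cell A) {..<nb A}" if "valid A"
proof (rule inj_onI)
  fix i j assume ij: "i \<in> {..<nb A}" "j \<in> {..<nb A}" "cell A i = cell A j"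
  have "cell A i \<noteq> {}" using validD(4)[OF that, of i] ij by auto
  then show "i = j" using cell_disjoint[OF that, of i j] ij by auto
qed

lemma cell_union: 
  assumes "valid A" "n \<le> nb A" 
  shows "(\<Union>i<n. {bp A i..bp A (Suc i)}) = (if n = 0 then {} else {bp A 0..bp A n})"
  using assms(2)
proof (induction n)
  case (Suc n)
  have "bp A 0 \<le> bp A n" "bp A n \<le> bp A (Suc n)"
    using bp_le[OF assms(1)] Suc by auto
  moreover have "(\<Union>i<Suc n. {bp A i..bp A (Suc i)}) = (\<Union>i<n. {bp A i..bp A (Suc i)}) \<union> {bp A n..bp A (Suc n)}"
    by (auto simp: less_Suc_eq)
  ultimately show ?case using Suc by auto
qed simp

section \<open>Orbitals, extended support and transition points read off a frame\<close>

lemma component_eq_interval: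
  fixes a b :: real
  assumes "{a<..<b} \<subseteq> S" "a \<notin> S" "b \<notin> S" "r \<in> {a<..<b}"
  shows "connected_component_set S r = {a<..<b}"
proof
  show "{a<..<b} \<subseteq> connected_component_set S r"
    using assms by (intro connected_component_maximal) auto
  have C: "connected (connected_component_set S r)" by simp
  have r: "r \<in> connected_component_set S r" using assms by auto
  have S: "connected_component_set S r \<subseteq> S" by (rule connected_component_subset)
  show "connected_component_set S r \<subseteq> {a<..<b}"
  proof
    fix y assume y: "y \<in> connected_component_set S r"
    have "y > a"
    proof (rule ccontr)
      assume "\<not> y > a"
      then have "{y..r} \<subseteq> connected_component_set S r" using connected_contains_Icc[OF C y r] by simp
      then show False using S assms \<open>\<not> y > a\<close> by (auto simp: subset_iff)
    qed
    moreover have "y < b"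
    proof (rule ccontr)
      assume "\<not> y < b"
      then have "{r..y} \<subseteq> connected_component_set S r" using connected_contains_Icc[OF C r y] by simp
      then show False using S assms \<open>\<not> y < b\<close> by (auto simp: subset_iff)
    qed
    ultimately show "y \<in> {a<..<b}" by simp
  qed
qed

text \<open>The breakpoints lie outside the support, so every cell is cut off on both sides and is a
  whole component.\<close>

lemma cells_orbitals:
  assumes v: "valid A" and S: "supt f = (\<Union>i<nb A. cell A i)"
  shows "orbitals f = cell A ` {..<nb A}"
proof -
  have bpn: "bp A j \<notin> supt f" if "j \<le> nb A" for j
    using bp_notin_cell[OF v] that S by auto
  have comp: "connected_component_set (supt f) r = cell A i" if "i < nb A" "r \<in> cell A i" for i r
    using that S bpn by (intro component_eq_interval) auto
  show ?thesis
  proof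
    show "orbitals f \<subseteq> cell A ` {..<nb A}"
    proof
      fix J assume "J \<in> orbitals f"
      then obtain r where "r \<in> supt f" "J = connected_component_set (supt f) r"
        unfolding orbitals_def by auto
      then show "J \<in> cell A ` {..<nb A}" using comp S by auto
    qed
    show "cell A ` {..<nb A} \<subseteq> orbitals f"
    proof
      fix J assume "J \<in> cell A ` {..<nb A}"
      then obtain i where i: "i < nb A" "J = cell A i" by auto
      obtain r where "r \<in> cell A i" using dense[OF validD(4)[OF v i(1)]] by auto
      then show "J \<in> orbitals f" unfolding orbitals_def using i S comp by fastforce
    qed
  qed
qed

lemma closure_finite_UN:
  "closure (\<Union>i\<in>I. S i) = (\<Union>i\<in>I. closure (S i))" if "finite I"
  using that by induction auto

text \<open>Consecutive closed cells share a breakpoint, so the closure of the support is one closed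
  interval even if the support is disconnected.\<close>

lemma cells_ext_supt:
  assumes v: "valid A" and S: "supt f = (\<Union>i<nb A. cell A i)"
  shows "ext_supt f = {bp A 0<..<bp A (nb A)}"
proof -
  have "closure (supt f) = (\<Union>i<nb A. closure (cell A i))"
    unfolding S by (simp add: closure_finite_UN del: closure_greaterThanLessThan)
  also have "\<dots> = (\<Union>i<nb A. {bp A i..bp A (Suc i)})"
    using validD(4)[OF v] by (intro SUP_cong) auto
  also have "\<dots> = {bp A 0..bp A (nb A)}"
    using v by (subst cell_union) (auto simp: valid_def)
  finally show ?thesis unfolding ext_supt_def by (simp add: interior_atLeastAtMost_real)
qed

lemma has_frameD:
  assumes "has_frame f A"
  shows "valid A" "homeo_plus (fst f)" "supt (fst f) = (\<Union>i<nb A. cell A i)"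
     "snd f = mk A ` {..<nb A}" "0 < nb A"
  using assms unfolding has_frame_def valid_def by auto

lemma has_frame_neg: 
  assumes "has_frame f A" "i < nb A div 2"
  shows "r \<in> cell A i \<Longrightarrow> fst f r < r" "fst f (im A i) = mk A i"
  using assms unfolding has_frame_def by (auto dest!: spec[of _ i])

lemma has_frame_pos: 
  assumes "has_frame f A" "i < nb A" "\<not> i < nb A div 2"
  shows "r \<in> cell A i \<Longrightarrow> fst f r > r" "fst f (mk A i) = im A i"
  using assms unfolding has_frame_def by (auto dest!: spec[of _ i])

lemma has_frame_orbitals: "orbitals (fst f) = cell A ` {..<nb A}" if "has_frame f A"
  using cells_orbitals has_frameD[OF that] by blast

lemma has_frame_ext_supt: "ext_supt (fst f) = {bp A 0<..<bp A (nb A)}" if "has_frame f A"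
  using cells_ext_supt has_frameD[OF that] by blast

lemma has_frame_card_orbitals: "card (orbitals (fst f)) = nb A" if "has_frame f A"
  using has_frame_orbitals[OF that] card_image[OF inj_cell] has_frameD[OF that] by simp

lemma has_frame_trans_pts: "trans_pts (fst f) = bp A ` {..nb A}" if "has_frame f A"
proof -
  note v = has_frameD(1)[OF that]
  have I: "Inf (cell A i) = bp A i" "Sup (cell A i) = bp A (Suc i)" if "i < nb A" for i
    using validD(4)[OF v that] by auto
  have "trans_pts (fst f) = Inf ` cell A ` {..<nb A} \<union> Sup ` cell A ` {..<nb A}"
    unfolding trans_pts_def has_frame_orbitals[OF that] by auto
  also have "\<dots> = bp A ` {..<nb A} \<union> bp A ` Suc ` {..<nb A}"
    using I by (auto simp: image_image)
  also have "\<dots> = bp A ` ({..<nb A} \<union> Suc ` {..<nb A})" by (simp add: image_Un)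
  also have "{..<nb A} \<union> Suc ` {..<nb A} = {..nb A}"
  proof -
    have "{..nb A} = insert 0 (Suc ` {..<nb A})" by (metis lessThan_Suc_atMost lessThan_Suc_eq_insert_0)
    then show ?thesis using has_frameD(5)[OF that] by auto
  qed
  finally show ?thesis .
qed

lemma has_frame_osc:
  assumes f: "has_frame f A" and g: "has_frame g B"
  shows "osc f g = int (card {j. j < nb B \<and> (\<exists>i\<le>nb A. bp A i \<in> cell B j)})"
proof -
  have "{J \<in> orbitals (fst g). \<exists>r\<in>trans_pts (fst f). r \<in> J}
      = cell B ` {j. j < nb B \<and> (\<exists>i\<le>nb A. bp A i \<in> cell B j)}"
    unfolding has_frame_orbitals[OF g] has_frame_trans_pts[OF f] by blast
  moreover have "inj_on (cell B) {j. j < nb B \<and> (\<exists>i\<le>nb A. bp A i \<in> cell B j)}"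
    by (rule inj_on_subset[OF inj_cell[OF has_frameD(1)[OF g]]]) auto
  ultimately show ?thesis unfolding osc_def by (simp add: card_image)
qed

section \<open>Marked bumps, feet and fastness\<close>

lemma supt_bump_on: "supt (bump_on f J) = J" if "J \<subseteq> supt f"
  using that unfolding supt_def bump_on_def by auto

text \<open>Monotonicity and surjectivity force 0 and 1 to be fixed; outside [0,1] the map is the
  identity by definition.\<close>

lemma homeo_plus_fix: 
  assumes "homeo_plus f" "r \<le> 0 \<or> 1 \<le> r" shows "f r = r"
proof -
  have m: "strict_mono_on {0..1} f" and i: "f ` {0..1} = {0..1}" and o: "r \<notin> {0..1} \<Longrightarrow> f r = r"
    using assms unfolding homeo_plus_def by auto
  have "f 0 = 0"
  proof -
    obtain z where z: "z \<in> {0..1}" "f z = 0" using i by (metis atLeastAtMost_iff imageE order_refl zero_le_one)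
    have "f 0 \<le> f z" using strict_mono_on_leD[OF m, of 0 z] z by auto
    moreover have "f 0 \<in> {0..1}" using i by (metis atLeastAtMost_iff imageI order_refl zero_le_one)
    ultimately show ?thesis using z by auto
  qed
  moreover have "f 1 = 1"
  proof -
    obtain z where z: "z \<in> {0..1}" "f z = 1" using i by (metis atLeastAtMost_iff imageE order_refl zero_le_one)
    have "f z \<le> f 1" using strict_mono_on_leD[OF m, of z 1] z by auto
    moreover have "f 1 \<in> {0..1}" using i by (metis atLeastAtMost_iff imageI order_refl zero_le_one)
    ultimately show ?thesis using z by auto
  qed
  ultimately show ?thesis using o assms(2) by (cases "r = 0 \<or> r = 1") auto
qed

lemma supt_subset: "supt f \<subseteq> {0<..<1}" if "homeo_plus f"
  using homeo_plus_fix[OF that] unfolding supt_def by fastforce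

lemma has_frame_mbumps:
  assumes f: "has_frame f A"
  shows "mbumps f = (\<lambda>i. (bump_on (fst f) (cell A i), mk A i)) ` {..<nb A}"
proof -
  note v = has_frameD(1)[OF f]
  have mk: "mk A i \<in> cell A j \<longleftrightarrow> i = j" if "i < nb A" "j < nb A" for i j
    using cell_disjoint[OF v that] validD[OF v that(1)] by fastforce
  have "mbumps f = {(bump_on (fst f) (cell A j), mk A i) | i j. i < nb A \<and> j < nb A \<and> mk A i \<in> cell A j}"
    unfolding mbumps_def has_frame_orbitals[OF f] has_frameD(4)[OF f] by blast
  also have "\<dots> = (\<lambda>i. (bump_on (fst f) (cell A i), mk A i)) ` {..<nb A}"
    using mk by fastforce
  finally show ?thesis .
qed

text \<open>For a negative bump, \<open>right_foot\<close> inverts the isolated bump on [0,1]; this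
  bump is therefore shown to be injective, and \<open>im A i\<close> is the preimage of the marker.
  For a positive bump \<open>im A i\<close> is the image.\<close>

lemma has_frame_feet:
  assumes f: "has_frame f A" and i: "i < nb A"
  shows "feet (bump_on (fst f) (cell A i), mk A i) = foot A i"
proof -
  note v = has_frameD(1)[OF f]
  let ?b = "bump_on (fst f) (cell A i)"
  have sub: "cell A i \<subseteq> supt (fst f)" using has_frameD(3)[OF f] i by auto
  have S: "supt ?b = cell A i" by (rule supt_bump_on[OF sub])
  have IS: "Inf (supt ?b) = bp A i" "Sup (supt ?b) = bp A (Suc i)"
    unfolding S using validD(4)[OF v i] by auto
  have mc: "mk A i \<in> cell A i" "im A i \<in> cell A i" using validD[OF v i] by auto
  have inj: "inj_on ?b {0..1}"
  proof -
    have m: "strict_mono_on {0..1} (fst f)" using has_frameD(2)[OF f] unfolding homeo_plus_def by auto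
    have fx: "fst f (bp A j) = bp A j" if "j \<le> nb A" for j
    proof -
      have "bp A j \<notin> supt (fst f)" using bp_notin_cell[OF v _ that] has_frameD(3)[OF f] by auto
      then show ?thesis using homeo_plus_fix[OF has_frameD(2)[OF f], of "bp A j"]
        by (cases "bp A j \<in> {0..1}") (auto simp: supt_def)
    qed
    have "cell A i \<subseteq> {0<..<1}" using sub supt_subset[OF has_frameD(2)[OF f]] by auto
    then have cl: "{bp A i..bp A (Suc i)} \<subseteq> {0..1}"
      using closure_mono[of "cell A i" "{0<..<1}"] validD(4)[OF v i] by auto
    \<comment> \<open>The ends of the cell are fixed, so the cell is mapped into itself and the two
      branches of \<open>bump_on\<close> have disjoint images.\<close>
    have inv: "fst f r \<in> cell A i" if "r \<in> cell A i" for r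
    proof -
      have "bp A i \<in> {0..1}" "bp A (Suc i) \<in> {0..1}" "r \<in> {0..1}" using cl that by auto
      then have "fst f (bp A i) < fst f r" "fst f r < fst f (bp A (Suc i))"
        using strict_mono_onD[OF m] that by auto
      then show ?thesis using fx i by auto
    qed
    show ?thesis
    proof (rule inj_onI)
      fix p q assume pq: "p \<in> {0..1}" "q \<in> {0..1}" "?b p = ?b q"
      show "p = q"
      proof (cases "p \<in> cell A i \<longleftrightarrow> q \<in> cell A i")
        case True
        then show ?thesis using pq strict_mono_on_eqD[OF m, of p q] unfolding bump_on_def by presburger
      next
        case False
        then have "(?b p \<in> cell A i) \<noteq> (?b q \<in> cell A i)" using inv unfolding bump_on_def by presburger
        then show ?thesis using pq(3) by simp
      qed
    qed
  qed
  have rf: "right_foot (?b, mk A i) = {im A i..<bp A (Suc i)}"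
  proof (cases "i < nb A div 2")
    case True
    \<comment> \<open>The marker alone, moved to the left, refutes the test for positivity, so
      \<open>right_foot\<close> takes its inverse branch.\<close>
    have "?b (mk A i) < mk A i" using has_frame_neg(1)[OF f True mc(1)] mc unfolding bump_on_def by auto
    then have n: "\<not> (\<forall>r\<in>supt ?b. ?b r > r)" unfolding S using mc by fastforce
    have "?b (im A i) = mk A i" using has_frame_neg(2)[OF f True] mc unfolding bump_on_def by auto
    moreover have "im A i \<in> {0..1}" using sub mc supt_subset[OF has_frameD(2)[OF f]] by (auto simp: subset_iff)
    ultimately have "the_inv_into {0..1} ?b (mk A i) = im A i" using the_inv_into_f_f[OF inj] by metis
    then show ?thesis using n IS(2) unfolding right_foot_def fst_conv snd_conv by (simp only: if_False)
  next
    case False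
    have c: "\<forall>r\<in>supt ?b. ?b r > r" unfolding S using has_frame_pos(1)[OF f i False] by (auto simp: bump_on_def)
    have "?b (mk A i) = im A i" using has_frame_pos(2)[OF f i False] mc unfolding bump_on_def by auto
    then show ?thesis unfolding right_foot_def fst_conv snd_conv if_P[OF c] IS(2) by (rule arg_cong)
  qed
  then show ?thesis using IS unfolding feet_def foot_def left_foot_def by simp
qed

lemma has_frame_marked: assumes f: "has_frame f A" shows "marked f"
proof -
  note v = has_frameD(1)[OF f]
  have mk: "mk A i \<in> cell A j \<longleftrightarrow> i = j" if "i < nb A" "j < nb A" for i j
    using cell_disjoint[OF v that] validD[OF v that(1)] by fastforce
  have "snd f \<subseteq> supt (fst f)" using mk unfolding has_frameD(3,4)[OF f] by fastforce
  moreover have "\<exists>!s. s \<in> snd f \<and> s \<in> J" if J: "J \<in> orbitals (fst f)" for J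
  proof -
    obtain i where i: "i < nb A" "J = cell A i" using J has_frame_orbitals[OF f] by auto
    show ?thesis unfolding i(2) has_frameD(4)[OF f]
    proof (rule ex1I)
      show "mk A i \<in> mk A ` {..<nb A} \<and> mk A i \<in> cell A i" using mk[OF i(1) i(1)] i(1) by blast
      show "s = mk A i" if "s \<in> mk A ` {..<nb A} \<and> s \<in> cell A i" for s using that mk[OF _ i(1)] by blast
    qed
  qed
  ultimately show ?thesis unfolding marked_def using has_frameD(2)[OF f] has_frame_orbitals[OF f] by auto
qed

text \<open>Feet of different bumps of one function lie in disjoint cells, so only feet of different
  functions matter. A bump common to both would give two left feet with the same left end, which
  overlap; hence disjoint feet also exclude common bumps.\<close>

lemma fast_iff:
  assumes f: "has_frame f A" and g: "has_frame g B" and "f \<noteq> g"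
  shows "fast {f, g} \<longleftrightarrow> feet_disjoint A B"
proof
  note vA = has_frameD(1)[OF f] and vB = has_frameD(1)[OF g]
  let ?a = "\<lambda>i. (bump_on (fst f) (cell A i), mk A i)" and ?b = "\<lambda>i. (bump_on (fst g) (cell B i), mk B i)"
  have Sa: "supt (fst (?a i)) = cell A i" if "i < nb A" for i
    using supt_bump_on[of "cell A i" "fst f"] has_frameD(3)[OF f] that by auto
  have Sb: "supt (fst (?b i)) = cell B i" if "i < nb B" for i
    using supt_bump_on[of "cell B i" "fst g"] has_frameD(3)[OF g] that by auto
  {
    assume F: "fast {f, g}"
    show "feet_disjoint A B" unfolding feet_disjoint_def
    proof (intro allI impI)
      fix i j assume ij: "i < nb A" "j < nb B"
      have a: "?a i \<in> mbumps f" and b: "?b j \<in> mbumps g"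
        unfolding has_frame_mbumps[OF f] has_frame_mbumps[OF g] using ij by auto
      have "fst ` mbumps f \<inter> fst ` mbumps g = {}" using F \<open>f \<noteq> g\<close> unfolding fast_def by auto
      then have "?a i \<noteq> ?b j" using a b by (metis disjoint_iff imageI)
      moreover have "\<forall>a\<in>\<Union>(mbumps ` {f, g}). \<forall>b\<in>\<Union>(mbumps ` {f, g}). a \<noteq> b \<longrightarrow> feet a \<inter> feet b = {}"
        using F unfolding fast_def by (elim conjE)
      moreover have "?a i \<in> \<Union>(mbumps ` {f, g})" "?b j \<in> \<Union>(mbumps ` {f, g})" using a b by blast+
      ultimately have "feet (?a i) \<inter> feet (?b j) = {}" by meson
      then show "foot A i \<inter> foot B j = {}" using has_frame_feet[OF f ij(1)] has_frame_feet[OF g ij(2)] by simp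
    qed
  }
  assume D: "feet_disjoint A B"
  have d: "foot A i \<inter> foot B j = {}" if "i < nb A" "j < nb B" for i j
    using D that unfolding feet_disjoint_def by auto
  have da: "foot A i \<inter> foot A j = {}" if "i < nb A" "j < nb A" "i \<noteq> j" for i j
    using cell_disjoint[OF vA that] foot_subset[OF vA] that by blast
  have db: "foot B i \<inter> foot B j = {}" if "i < nb B" "j < nb B" "i \<noteq> j" for i j
    using cell_disjoint[OF vB that] foot_subset[OF vB] that by blast
  have ab: "fst (?a i) \<noteq> fst (?b j)" if ij: "i < nb A" "j < nb B" for i j
  proof
    assume "fst (?a i) = fst (?b j)"
    then have c: "cell A i = cell B j" using Sa[OF ij(1)] Sb[OF ij(2)] by metis
    then have "bp A i = bp B j"
      using validD(4)[OF vA ij(1)] validD(4)[OF vB ij(2)] c by (metis cInf_greaterThanLessThan)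
    moreover obtain r where "bp A i < r" "r < min (mk A i) (mk B j)"
      using dense[of "bp A i" "min (mk A i) (mk B j)"] validD(1)[OF vA ij(1)] validD(1)[OF vB ij(2)] calculation by auto
    ultimately have "r \<in> foot A i \<inter> foot B j" unfolding foot_def by auto
    then show False using d[OF ij] by auto
  qed
  have 1: "fst ` mbumps f \<inter> fst ` mbumps g = {}"
    unfolding has_frame_mbumps[OF f] has_frame_mbumps[OF g] using ab by fastforce
  have 2: "feet a \<inter> feet b = {}" 
    if ab: "a \<in> mbumps f \<union> mbumps g" "b \<in> mbumps f \<union> mbumps g" "a \<noteq> b" for a b
  proof -
    have cases: "(\<exists>i<nb A. c = ?a i) \<or> (\<exists>i<nb B. c = ?b i)" if "c \<in> mbumps f \<union> mbumps g" for c
      using that unfolding has_frame_mbumps[OF f] has_frame_mbumps[OF g] by blast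
    show ?thesis
      using cases[OF ab(1)] cases[OF ab(2)]
    proof (elim disjE exE conjE)
      fix i j assume "i < nb A" "j < nb A" "a = ?a i" "b = ?a j"
      then show ?thesis using has_frame_feet[OF f] da ab(3) by metis
    next
      fix i j assume "i < nb A" "j < nb B" "a = ?a i" "b = ?b j"
      then show ?thesis using has_frame_feet[OF f] has_frame_feet[OF g] d by metis
    next
      fix i j assume "i < nb B" "j < nb A" "a = ?b i" "b = ?a j"
      then show ?thesis using has_frame_feet[OF f] has_frame_feet[OF g] d by (metis Int_commute)
    next
      fix i j assume "i < nb B" "j < nb B" "a = ?b i" "b = ?b j"
      then show ?thesis using has_frame_feet[OF g] db ab(3) by metis
    qed
  qed
  show "fast {f, g}" unfolding fast_def
    using has_frame_marked[OF f] has_frame_marked[OF g] 1 2 by (simp add: Int_commute)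
qed

text \<open>Of two disjoint non-empty intervals one ends before the other begins. The four pairings
  of left and right feet give four alternatives that mention only the order of points, the form that
  linear arithmetic and increasing maps can handle.\<close>

lemma feet_disjointD:
  assumes "feet_disjoint A B" "valid A" "valid B" "i < nb A" "j < nb B"
  shows "mk A i \<le> bp B j \<or> mk B j \<le> bp A i"
    "bp A (Suc i) \<le> im B j \<or> bp B (Suc j) \<le> im A i"
    "mk A i \<le> im B j \<or> bp B (Suc j) \<le> bp A i"
    "mk B j \<le> im A i \<or> bp A (Suc i) \<le> bp B j"
proof -
  have d: "foot A i \<inter> foot B j = {}" using assms unfolding feet_disjoint_def by auto
  note vA = validD[OF assms(2,4)] and vB = validD[OF assms(3,5)]
  show "mk A i \<le> bp B j \<or> mk B j \<le> bp A i"
  proof (rule ccontr)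
    assume c: "\<not> ?thesis"
    obtain r where "max (bp A i) (bp B j) < r" "r < min (mk A i) (mk B j)"
      using dense[of "max (bp A i) (bp B j)" "min (mk A i) (mk B j)"] c vA vB by auto
    then have "r \<in> foot A i \<inter> foot B j" unfolding foot_def by auto
    then show False using d by auto
  qed
  show "bp A (Suc i) \<le> im B j \<or> bp B (Suc j) \<le> im A i"
  proof (rule ccontr)
    assume c: "\<not> ?thesis"
    \<comment> \<open>Right feet contain their left ends, so the larger of these is a common point;
      the cases with an open left foot need a point in between.\<close>
    then have "max (im A i) (im B j) \<in> foot A i \<inter> foot B j" 
      using vA vB unfolding foot_def by auto
    then show False using d by auto
  qed
  show "mk A i \<le> im B j \<or> bp B (Suc j) \<le> bp A i"
  proof (rule ccontr)
    assume c: "\<not> ?thesis"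
    obtain r where "max (bp A i) (im B j) < r" "r < min (mk A i) (bp B (Suc j))"
      using dense[of "max (bp A i) (im B j)" "min (mk A i) (bp B (Suc j))"] c vA vB by auto
    then have "r \<in> foot A i \<inter> foot B j" unfolding foot_def by auto
    then show False using d by auto
  qed
  show "mk B j \<le> im A i \<or> bp A (Suc i) \<le> bp B j"
  proof (rule ccontr)
    assume c: "\<not> ?thesis"
    obtain r where "max (bp B j) (im A i) < r" "r < min (mk B j) (bp A (Suc i))"
      using dense[of "max (bp B j) (im A i)" "min (mk B j) (bp A (Suc i))"] c vA vB by auto
    then have "r \<in> foot A i \<inter> foot B j" unfolding foot_def by auto
    then show False using d by auto
  qed
qed

text \<open>Of n bumps, \<open>n div 2\<close> are negative and \<open>n - n div 2\<close> positive,
  and these numbers differ by 0 or 1.\<close>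

lemma has_frame_standard: assumes f: "has_frame f A" shows "standard f"
proof -
  note v = has_frameD(1)[OF f]
  let ?n = "nb A"
  have ne: "\<exists>r. r \<in> cell A i" if "i < ?n" for i using dense[OF validD(4)[OF v that]] by auto
  have half: "i < ?n" if "i < ?n div 2" for i using that by auto
  have O: "cell A i \<in> orbitals (fst f)" if "i < ?n" for i using that has_frame_orbitals[OF f] by auto
  have P: "pos_orbital (fst f) (cell A i) \<longleftrightarrow> \<not> i < ?n div 2" if "i < ?n" for i
    using has_frame_neg(1)[OF f, of i] has_frame_pos(1)[OF f that] ne[OF that] O[OF that]
    unfolding pos_orbital_def by (meson less_asym)
  have N: "neg_orbital (fst f) (cell A i) \<longleftrightarrow> i < ?n div 2" if "i < ?n" for i
    using has_frame_neg(1)[OF f, of i] has_frame_pos(1)[OF f that] ne[OF that] O[OF that]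
    unfolding neg_orbital_def by (meson less_asym)
  have PS: "{J. pos_orbital (fst f) J} = cell A ` {?n div 2..<?n}"
    using P unfolding pos_orbital_def has_frame_orbitals[OF f] by fastforce
  have NS: "{J. neg_orbital (fst f) J} = cell A ` {..<?n div 2}"
    using N half unfolding neg_orbital_def has_frame_orbitals[OF f] by fastforce
  have cP: "card {J. pos_orbital (fst f) J} = ?n - ?n div 2" unfolding PS
    by (subst card_image[OF inj_on_subset[OF inj_cell[OF v]]]) auto
  have cN: "card {J. neg_orbital (fst f) J} = ?n div 2" unfolding NS
    by (subst card_image[OF inj_on_subset[OF inj_cell[OF v]]]) auto
  have "x < y" if PN: "pos_orbital (fst f) Q" "neg_orbital (fst f) R" "x \<in> R" "y \<in> Q" for Q R x y
  proof -
    have "Q \<in> {J. pos_orbital (fst f) J}" "R \<in> {J. neg_orbital (fst f) J}" using PN by auto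
    note QR = this[unfolded PS NS]
    obtain i where i: "?n div 2 \<le> i" "i < ?n" "Q = cell A i" using QR(1) by auto
    obtain j where j: "j < ?n div 2" "R = cell A j" using QR(2) by auto
    have "bp A (Suc j) \<le> bp A i" using bp_le[OF v] i j by auto
    then show ?thesis using PN i j by auto
  qed
  moreover have "bp A 0 < bp A ?n" using bp_less[OF v] has_frameD(5)[OF f] by auto
  moreover have "?n - ?n div 2 = ?n div 2 \<or> ?n - ?n div 2 = ?n div 2 + 1" by linarith
  ultimately show ?thesis
    unfolding standard_def using cP cN has_frame_marked[OF f] has_frame_ext_supt[OF f] by (metis (no_types, lifting))
qed

section \<open>Gluing homeomorphisms\<close>

lemma homeo_plusI:
  assumes c: "continuous_on {0..1} f" and m: "strict_mono_on {0..1} f" and o: "\<And>t. t \<notin> {0<..<1} \<Longrightarrow> f t = t"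
  shows "homeo_plus f"
proof -
  have e: "f 0 = 0" "f 1 = 1" using o by auto
  have "f ` {0..1} = {0..1}"
  proof
    show "f ` {0..1} \<subseteq> {0..1}"
      using strict_mono_on_leD[OF m, of 0] strict_mono_on_leD[OF m, of _ 1] e by fastforce
    show "{0..1} \<subseteq> f ` {0..1}"
    proof
      fix y :: real assume "y \<in> {0..1}"
      then obtain x where "0 \<le> x" "x \<le> 1" "f x = y" using IVT'[of f 0 y 1] e c by auto
      then show "y \<in> f ` {0..1}" by auto
    qed
  qed
  then show ?thesis unfolding homeo_plus_def using assms by auto
qed

lemma homeo_plus_id: "homeo_plus (\<lambda>t. t)"
  by (rule homeo_plusI) (auto simp: strict_mono_on_def)

lemma homeo_plus_glue:
  assumes f: "homeo_plus f" and g: "homeo_plus g" and c: "f c = c" "g c = c"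
  shows "homeo_plus (\<lambda>t. if t \<le> c then f t else g t)"
proof (cases "c \<in> {0..1}")
  case False
  \<comment> \<open>Outside [0,1] both maps are the identity, so the glued map coincides with one of
    them.\<close>
  then consider "c < 0" | "1 < c" by fastforce
  then show ?thesis
  proof cases
    case 1
    have "(\<lambda>t. if t \<le> c then f t else g t) = g"
      using 1 homeo_plus_fix[OF f] homeo_plus_fix[OF g] by fastforce
    then show ?thesis using g by simp
  next
    case 2
    have "(\<lambda>t. if t \<le> c then f t else g t) = f"
      using 2 homeo_plus_fix[OF f] homeo_plus_fix[OF g] by fastforce
    then show ?thesis using f by simp
  qed
next
  case True
  have cf: "continuous_on {0..1} f" "continuous_on {0..1} g" 
    and mf: "strict_mono_on {0..1} f" and mg: "strict_mono_on {0..1} g"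
    using f g unfolding homeo_plus_def by auto
  show ?thesis
  proof (rule homeo_plusI)
    have "continuous_on ({0..c} \<union> {c..1}) (\<lambda>t. if t \<le> c then f t else g t)"
      by (rule continuous_on_If) (use True cf c in \<open>auto intro: continuous_on_subset\<close>)
    moreover have "{0..c} \<union> {c..1} = {0..1}" using True by auto
    ultimately show "continuous_on {0..1} (\<lambda>t. if t \<le> c then f t else g t)" by simp
    show "strict_mono_on {0..1} (\<lambda>t. if t \<le> c then f t else g t)"
    proof (rule strict_mono_onI)
      fix r s :: real assume rs: "r \<in> {0..1}" "s \<in> {0..1}" "r < s"
      have "f r \<le> c" if "r \<le> c" using strict_mono_on_leD[OF mf, of r c] that True rs c by auto
      moreover have "c < g s" if "c < s" using strict_mono_onD[OF mg, of c s] that True rs c by auto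
      ultimately show "(if r \<le> c then f r else g r) < (if s \<le> c then f s else g s)"
        using strict_mono_onD[OF mf, of r s] strict_mono_onD[OF mg, of r s] rs by auto
    qed
    show "(if t \<le> c then f t else g t) = t" if "t \<notin> {0<..<1}" for t
      using homeo_plus_fix[OF f, of t] homeo_plus_fix[OF g, of t] that by (auto simp: not_less)
  qed
qed

lemma homeo_plus_restrict:
  assumes f: "homeo_plus f" and "f u = u" "f v = v"
  shows "homeo_plus (\<lambda>t. if t \<in> {u..v} then f t else t)"
proof (cases "u \<le> v")
  case True
  have "homeo_plus (\<lambda>t. if t \<le> u then t else if t \<le> v then f t else t)"
    by (intro homeo_plus_glue homeo_plus_id f) (use assms True in auto)
  also have "(\<lambda>t. if t \<le> u then t else if t \<le> v then f t else t) = (\<lambda>t. if t \<in> {u..v} then f t else t)"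
    using assms True by (auto simp: fun_eq_iff)
  finally show ?thesis .
qed (use homeo_plus_id in auto)

lemma homeo_plus_fixed: "f t = t" if "homeo_plus f" "t \<notin> supt f"
  using that unfolding homeo_plus_def supt_def by auto

lemma homeo_plus_cell:
  assumes f: "homeo_plus f" and fx: "f u = u" "f v = v" and sub: "{u<..<v} \<subseteq> {0..1}" and r: "r \<in> {u<..<v}"
  shows "f r \<in> {u<..<v}" "\<exists>q\<in>{u<..<v}. f q = r"
proof -
  have m: "strict_mono_on {0..1} f" and c: "continuous_on {0..1} f" using f unfolding homeo_plus_def by auto
  have "closure {u<..<v} \<subseteq> {0..1}" using closure_mono[OF sub] by simp
  then have cl: "{u..v} \<subseteq> {0..1}" using r by simp
  show "f r \<in> {u<..<v}"
    using strict_mono_onD[OF m, of u r] strict_mono_onD[OF m, of r v] fx r cl by (auto simp: subset_iff)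
  obtain q where "u \<le> q" "q \<le> v" "f q = r"
    using IVT'[of f u r v] continuous_on_subset[OF c cl] fx r by auto
  then show "\<exists>q\<in>{u<..<v}. f q = r" using fx r by (intro bexI[of _ q]) (auto simp: less_le)
qed

section \<open>Standard functions have frames\<close>

lemma open_supt: "open (supt f)" if "homeo_plus f"
proof -
  have "continuous_on {0<..<1} (\<lambda>t. f t - t)"
    using that unfolding homeo_plus_def by (intro continuous_intros) (auto intro: continuous_on_subset)
  then have "open ({0<..<1} \<inter> (\<lambda>t. f t - t) -` (- {0}))"
    by (intro continuous_open_preimage) auto
  moreover have "supt f = {0<..<1} \<inter> (\<lambda>t. f t - t) -` (- {0})"
    using supt_subset[OF that] unfolding supt_def by auto
  ultimately show ?thesis by simp
qed

lemma Union_orbitals: "\<Union> (orbitals f) = supt f"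
proof
  show "\<Union> (orbitals f) \<subseteq> supt f" unfolding orbitals_def using connected_component_subset[of "supt f"] by blast
  show "supt f \<subseteq> \<Union> (orbitals f)"
  proof
    fix r assume r: "r \<in> supt f"
    then have "r \<in> connected_component_set (supt f) r" by simp
    then show "r \<in> \<Union> (orbitals f)" unfolding orbitals_def using r by blast
  qed
qed

text \<open>Induction on the largest excluded point \<open>m\<close>: the interval from
  \<open>m\<close> to \<open>b\<close> is appended to those found for \<open>{a<..<m}\<close>, which
  is why \<open>b\<close> varies.\<close>

lemma gap_enumeration:
  fixes a b :: real
  assumes "finite Z" "Z \<subseteq> {a<..<b}" "a < b"
  shows "\<exists>n x. 0 < n \<and> x 0 = a \<and> x n = b \<and> (\<forall>i<n. x i < x (Suc i))
     \<and> {a<..<b} - Z = (\<Union>i<n. {x i<..<x (Suc i)})"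
  using assms
proof (induction Z arbitrary: b rule: finite_linorder_max_induct)
  case empty
  show ?case using empty by (intro exI[of _ 1] exI[of _ "\<lambda>i. if i = 0 then a else b"]) auto
next
  case (insert m Z)
  have "Z \<subseteq> {a<..<m}" "a < m" using insert by auto
  from insert.IH[OF this] obtain n x where x: "0 < n" "x 0 = a" "x n = m" "\<forall>i<n. x i < x (Suc i)"
     "{a<..<m} - Z = (\<Union>i<n. {x i<..<x (Suc i)})"
    by auto
  define y where "y = x(Suc n := b)"
  have y: "y i = x i" if "i \<le> n" for i using that unfolding y_def by auto
  have "(\<Union>i<Suc n. {y i<..<y (Suc i)}) = (\<Union>i<n. {x i<..<x (Suc i)}) \<union> {m<..<b}"
  proof -
    have "(\<Union>i<n. {y i<..<y (Suc i)}) = (\<Union>i<n. {x i<..<x (Suc i)})"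
      by (rule SUP_cong) (auto simp: y_def)
    moreover have "{y n<..<y (Suc n)} = {m<..<b}" using x(3) by (simp add: y_def)
    ultimately show ?thesis by (simp add: lessThan_Suc Un_commute)
  qed
  also have "\<dots> = {a<..<b} - insert m Z"
    unfolding x(5)[symmetric] using insert by force
  finally show ?case
    using x y insert.prems by (intro exI[of _ "Suc n"] exI[of _ y]) (auto simp: less_Suc_eq y_def)
qed

text \<open>A fixed point inside the extended support is a limit of the support, hence lies in the
  closure of one of the finitely many orbitals. Not lying in the support, it is an end of that
  orbital.\<close>

lemma finite_fixed_points:
  assumes f: "homeo_plus f" and fin: "finite (orbitals f)" and ext: "ext_supt f = {a<..<b}" "a < b"
  shows "supt f \<subseteq> {a<..<b}" "finite ({a<..<b} - supt f)"
proof -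
  show "supt f \<subseteq> {a<..<b}"
    unfolding ext(1)[symmetric] ext_supt_def by (rule interior_maximal[OF closure_subset open_supt[OF f]])
  have "z \<in> Inf ` orbitals f \<union> Sup ` orbitals f" if z: "z \<in> {a<..<b} - supt f" for z
  proof -
    have "z \<in> closure (supt f)"
      using z interior_subset[of "closure (supt f)"] unfolding ext(1)[symmetric] ext_supt_def by auto
    then have "z \<in> (\<Union>J\<in>orbitals f. closure J)"
      using closure_finite_UN[OF fin, of "\<lambda>J. J"] Union_orbitals[of f] by simp
    then obtain J where J: "J \<in> orbitals f" "z \<in> closure J" by auto
    have con: "connected J" and sub: "J \<subseteq> supt f"
      using J(1) Union_orbitals[of f] unfolding orbitals_def by auto
    have "J \<subseteq> {0..1}" using sub supt_subset[OF f] by auto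
    then have bdd: "bdd_below J" "bdd_above J" by (meson bdd_below_Icc bdd_below_mono bdd_above_Icc bdd_above_mono)+
    have ne: "J \<noteq> {}" using J(2) by auto
    have "J \<subseteq> {Inf J..Sup J}" using bdd by (auto intro: cInf_lower cSup_upper)
    then have "z \<in> {Inf J..Sup J}" using J(2) closure_minimal by blast
    moreover have "\<not> (Inf J < z \<and> z < Sup J)"
    proof
      assume "Inf J < z \<and> z < Sup J"
      then obtain p q where pq: "p \<in> J" "p < z" "q \<in> J" "z < q"
        using cInf_less_iff[OF ne bdd(1)] less_cSup_iff[OF ne bdd(2)] by blast
      then have "z \<in> J" using connected_contains_Icc[OF con pq(1,3)] by auto
      then show False using z sub by auto
    qed
    ultimately have "z = Inf J \<or> z = Sup J" by auto
    then show ?thesis using J(1) by auto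
  qed
  then have "{a<..<b} - supt f \<subseteq> Inf ` orbitals f \<union> Sup ` orbitals f" by blast
  then show "finite ({a<..<b} - supt f)" using fin by (meson finite_Un finite_imageI finite_subset)
qed

text \<open>Otherwise \<open>f t - t\<close> would vanish somewhere on the connected interval,
  against the interval lying in the support.\<close>

lemma moves_one_way:
  assumes f: "homeo_plus f" and sub: "{u<..<v} \<subseteq> supt f"
  shows "(\<forall>r\<in>{u<..<v}. f r > r) \<or> (\<forall>r\<in>{u<..<v}. f r < r)"
proof (rule ccontr)
  assume "\<not> ?thesis"
  then obtain p q where pq: "p \<in> {u<..<v}" "f p \<le> p" "q \<in> {u<..<v}" "q \<le> f q"
    by (meson not_less)
  have "{u<..<v} \<subseteq> {0..1}" using sub unfolding supt_def by auto
  then have c: "continuous_on {u<..<v} (\<lambda>t. f t - t)"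
    using f unfolding homeo_plus_def by (intro continuous_intros) (auto intro: continuous_on_subset)
  have "connected ((\<lambda>t. f t - t) ` {u<..<v})"
    by (rule connected_continuous_image[OF c]) simp
  moreover have "f p - p \<in> (\<lambda>t. f t - t) ` {u<..<v}" "f q - q \<in> (\<lambda>t. f t - t) ` {u<..<v}" using pq by auto
  ultimately have "{f p - p..f q - q} \<subseteq> (\<lambda>t. f t - t) ` {u<..<v}" by (rule connected_contains_Icc)
  moreover have "0 \<in> {f p - p..f q - q}" using pq by simp
  ultimately have "0 \<in> (\<lambda>t. f t - t) ` {u<..<v}" by blast
  then obtain z where "z \<in> {u<..<v}" "f z = z" by auto
  then show False using sub unfolding supt_def by auto
qed

text \<open>Lets a downward closed set of indices be named by its size: the negative bumps here, and
  later the elements lying left of the greatest one.\<close>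

lemma initial_segment:
  fixes N :: "nat set"
  assumes "finite N" "\<And>i j. i \<in> N \<Longrightarrow> j < i \<Longrightarrow> j \<in> N"
  shows "N = {..<card N}"
proof (rule card_subset_eq)
  show "N \<subseteq> {..<card N}"
  proof
    fix i assume "i \<in> N"
    then have "{..i} \<subseteq> N" using assms(2) by (auto simp: le_less)
    then have "card {..i} \<le> card N" using assms(1) card_mono by blast
    then show "i \<in> {..<card N}" by simp
  qed
qed auto

lemma standard_has_frame: assumes "standard F" shows "\<exists>A. has_frame F A"
proof -
  define f where "f = fst F"
  obtain a b where ab: "a < b" "ext_supt f = {a<..<b}" using assms unfolding standard_def f_def by auto
  have mF: "marked F" using assms unfolding standard_def by auto
  then have f: "homeo_plus f" and fin: "finite (orbitals f)" and sub: "snd F \<subseteq> supt f"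
    and un: "\<And>J. J \<in> orbitals f \<Longrightarrow> \<exists>!s. s \<in> snd F \<and> s \<in> J" unfolding marked_def f_def by auto
  note fp = finite_fixed_points[OF f fin ab(2,1)]
  obtain n x where x: "0 < n" "x 0 = a" "x n = b" "\<And>i. i<n \<Longrightarrow> x i < x (Suc i)"
     "{a<..<b} - ({a<..<b} - supt f) = (\<Union>i<n. {x i<..<x (Suc i)})"
    using gap_enumeration[OF fp(2) _ ab(1)] by blast
  have S: "supt f = (\<Union>i<n. {x i<..<x (Suc i)})" using x(5) fp(1) by auto
  \<comment> \<open>An auxiliary frame whose markers at the thirds are placeholders; it only makes
    the lemmas on cells available for the breakpoints \<open>x\<close>.\<close>
  define A0 where "A0 = Frame n x (\<lambda>i. (2 * x i + x (Suc i)) / 3) (\<lambda>i. (x i + 2 * x (Suc i)) / 3)"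
  have sel: "nb A0 = n" "bp A0 = x" unfolding A0_def by auto
  have v0: "valid A0" unfolding valid_def using x(1,4) by (auto simp: A0_def field_simps)
  let ?c = "\<lambda>i. {x i<..<x (Suc i)}"
  have orb: "orbitals f = ?c ` {..<n}" using cells_orbitals[OF v0, of f] S unfolding sel by simp
  have inj: "inj_on ?c {..<n}" using inj_cell[OF v0] unfolding sel .
  have fx: "f (x i) = x i" if "i \<le> n" for i
    using bp_notin_cell[OF v0, of _ i] that S homeo_plus_fixed[OF f] unfolding sel by auto
  have c01: "?c i \<subseteq> {0..1}" and cS: "?c i \<subseteq> supt f" if "i < n" for i
    using that supt_subset[OF f] S by auto
  define P where "P = {i. i < n \<and> (\<forall>r\<in>?c i. f r > r)}"
  define N where "N = {i. i < n \<and> (\<forall>r\<in>?c i. f r < r)}"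
  have ne: "\<exists>r. r \<in> ?c i" if "i < n" for i using dense[OF x(4)[OF that]] by auto
  have PN: "P \<union> N = {..<n}" using moves_one_way[OF f cS] unfolding P_def N_def by auto
  have dis: "P \<inter> N = {}" unfolding P_def N_def using ne by (auto simp del: greaterThanLessThan_iff) (meson less_asym)
  have pos: "{J. pos_orbital f J} = ?c ` P" and neg: "{J. neg_orbital f J} = ?c ` N"
    unfolding pos_orbital_def neg_orbital_def orb P_def N_def by auto
  have fPN: "finite P" "finite N" unfolding P_def N_def by auto
  have sPN: "P \<subseteq> {..<n}" "N \<subseteq> {..<n}" unfolding P_def N_def by auto
  have "card {J. pos_orbital f J} = card {J. neg_orbital f J} \<or> card {J. pos_orbital f J} = card {J. neg_orbital f J} + 1"
    using assms unfolding standard_def f_def by auto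
  then have "card P = card N \<or> card P = card N + 1"
    unfolding pos neg card_image[OF inj_on_subset[OF inj sPN(1)]] card_image[OF inj_on_subset[OF inj sPN(2)]] .
  moreover have "card P + card N = n" using card_Un_disjoint[OF fPN dis] PN by simp
  \<comment> \<open>The two counts add up to \<open>n\<close> and differ by 0 or 1, which determines
    the number of negative cells.\<close>
  ultimately have cN: "card N = n div 2" by linarith
  have NP: "i < j" if ij: "i \<in> N" "j \<in> P" for i j
  proof -
    obtain r s where rs: "r \<in> ?c i" "s \<in> ?c j" using ne ij sPN by blast
    have "pos_orbital f (?c j)" "neg_orbital f (?c i)" using pos neg ij by auto
    then have "r < s" using assms rs unfolding standard_def f_def by blast
    then have "x i < x (Suc j)" using rs by auto
    moreover have "i < n" "j < n" using ij sPN by auto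
    ultimately have "i < Suc j" using bp_less_iff[OF v0, of i "Suc j"] unfolding sel by simp
    moreover have "i \<noteq> j" using dis ij by auto
    ultimately show ?thesis by simp
  qed
  have "N = {..<card N}"
  proof (rule initial_segment[OF fPN(2)])
    fix i j assume "i \<in> N" "j < i"
    moreover from this have "j \<in> P \<union> N" using PN sPN by auto
    ultimately show "j \<in> N" using NP[of i j] by auto
  qed
  then have N: "N = {..<n div 2}" using cN by simp
  define Q where "Q = (\<lambda>i s t. x i < s \<and> s < t \<and> t < x (Suc i) \<and> s \<in> snd F 
     \<and> (if i < n div 2 then (\<forall>r\<in>?c i. f r < r) \<and> f t = s else (\<forall>r\<in>?c i. f r > r) \<and> f s = t))"
  have "\<exists>s t. Q i s t"
    if i: "i < n" for i
  proof -
    have "?c i \<in> orbitals f" using orb i by auto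
    then obtain s where s: "s \<in> snd F" "s \<in> ?c i" using un by blast
    note hc = homeo_plus_cell[OF f fx fx c01[OF i] s(2)]
    show ?thesis
    \<comment> \<open>In a negative cell the partner \<open>t\<close> of the marker is its preimage,
      which exists because the cell is mapped onto itself; in a positive cell it is the
      image.\<close>
    proof (cases "i < n div 2")
      case True
      then have n: "\<forall>r\<in>?c i. f r < r" using N unfolding N_def by auto
      obtain t where "t \<in> ?c i" "f t = s" using hc(2) i by auto
      then show ?thesis unfolding Q_def using s n True by (intro exI[of _ s] exI[of _ t]) auto
    next
      case False
      then have "i \<in> P" using N PN i by auto
      then have n: "\<forall>r\<in>?c i. f r > r" unfolding P_def by auto
      then show ?thesis unfolding Q_def using s n False hc(1) i by (intro exI[of _ s] exI[of _ "f s"]) auto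
    qed
  qed
  then obtain s t where "\<And>i. i < n \<Longrightarrow> Q i (s i) (t i)" by metis
  note st = this[unfolded Q_def]
  have sc: "s i \<in> ?c i" if "i < n" for i using st[OF that] by auto
  have "snd F = s ` {..<n}"
  proof
    show "snd F \<subseteq> s ` {..<n}"
    proof
      fix r assume r: "r \<in> snd F"
      then obtain i where i: "i < n" "r \<in> ?c i" using sub S by auto
      then have "?c i \<in> orbitals f" using orb by auto
      then have "r = s i" using un[of "?c i"] r i sc st by blast
      then show "r \<in> s ` {..<n}" using i by auto
    qed
  qed (use st in auto)
  then have "has_frame F (Frame n x s t)"
    unfolding has_frame_def valid_def using x(1) st f S unfolding f_def by simp
  then show ?thesis by blast
qed

section \<open>The function \<open>f\<^sup>\<circ>\<close>\<close>

text \<open>The frame of the restriction to the non-extreme orbitals. It is meaningful for more than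
  two orbitals only; otherwise the truncated subtraction leaves no bump.\<close>

definition core :: "frame \<Rightarrow> frame" where
  "core B = Frame (nb B - 2) (\<lambda>i. bp B (Suc i)) (\<lambda>i. mk B (Suc i)) (\<lambda>i. im B (Suc i))"

lemma core_sel [simp]: "nb (core B) = nb B - 2" "bp (core B) i = bp B (Suc i)" 
  "mk (core B) i = mk B (Suc i)" "im (core B) i = im B (Suc i)"
  unfolding core_def by auto

text \<open>Possible frames of \<open>f\<^sup>\<circ>\<close>.  With at most two orbitals the new bump has an arbitrary
  marker, so only the breakpoints are determined.\<close>

definition circ_frame :: "frame \<Rightarrow> frame \<Rightarrow> bool" where
  "circ_frame B C \<longleftrightarrow> (2 < nb B \<and> C = core B) \<or>
     (nb B \<le> 2 \<and> nb C = 1 \<and> bp C 0 = bp B (nb B - 1) \<and> bp C 1 = mk B (nb B - 1))"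

lemma valid_core: "valid (core B)" if "valid B" "2 < nb B"
  using that unfolding valid_def by auto

lemma cell_lt: "(\<forall>p\<in>cell B i. \<forall>q\<in>cell B j. p < q) \<longleftrightarrow> i < j" if v: "valid B" "i < nb B" "j < nb B"
proof
  assume a: "\<forall>p\<in>cell B i. \<forall>q\<in>cell B j. p < q"
  obtain p q where pq: "p \<in> cell B i" "q \<in> cell B j" 
    using dense[OF validD(4)[OF v(1,2)]] dense[OF validD(4)[OF v(1,3)]] by auto
  then have "p < q" using a by blast
  then have "bp B i < bp B (Suc j)" using pq by simp
  then have "i < Suc j" using bp_less_iff[OF that(1), of i "Suc j"] that by auto
  moreover have "i \<noteq> j" using a pq by blast
  ultimately show "i < j" by simp
next
  assume "i < j"
  then have "bp B (Suc i) \<le> bp B j" using bp_le[OF that(1)] that by auto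
  then show "\<forall>p\<in>cell B i. \<forall>q\<in>cell B j. p < q" by auto
qed

text \<open>The cells with a cell on either side are those numbered 1 to \<open>nb B - 2\<close>.
  Their union is the support between two fixed breakpoints, so restricting to it gives a
  homeomorphism again.\<close>

lemma circ_large:
  assumes g: "has_frame g B" and n: "2 < nb B"
  shows "\<exists>h. has_frame h (core B) \<and> (\<forall>h'. circ g h' \<longleftrightarrow> h' = h)"
proof -
  note v = has_frameD(1)[OF g] and hp = has_frameD(2)[OF g] and S = has_frameD(3)[OF g]
  let ?n = "nb B"
  define U where "U = (\<Union>i<nb (core B). cell (core B) i)"
  let ?O = "orbitals (fst g)"
  have "{J \<in> ?O. \<exists>J1\<in>?O. \<exists>J2\<in>?O. (\<forall>x\<in>J1. \<forall>y\<in>J. x < y) \<and> (\<forall>x\<in>J. \<forall>y\<in>J2. x < y)} 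
    = cell B ` {i. i < ?n \<and> (\<exists>j<?n. \<exists>k<?n. (\<forall>x\<in>cell B j. \<forall>y\<in>cell B i. x < y) \<and> (\<forall>x\<in>cell B i. \<forall>y\<in>cell B k. x < y))}"
    unfolding has_frame_orbitals[OF g] by blast
  also have "{i. i < ?n \<and> (\<exists>j<?n. \<exists>k<?n. (\<forall>x\<in>cell B j. \<forall>y\<in>cell B i. x < y) \<and> (\<forall>x\<in>cell B i. \<forall>y\<in>cell B k. x < y))}
     = {i. i < ?n \<and> (\<exists>j<?n. \<exists>k<?n. j < i \<and> i < k)}"
    by (intro Collect_cong conj_cong refl ex_cong1; rule cell_lt[OF v]; assumption)
  also have "\<dots> = Suc ` {..<?n - 2}"
  proof (intro equalityI subsetI)
    fix i assume "i \<in> {i. i < ?n \<and> (\<exists>j<?n. \<exists>k<?n. j < i \<and> i < k)}"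
    then show "i \<in> Suc ` {..<?n - 2}" by (cases i) auto
  next
    fix i assume "i \<in> Suc ` {..<?n - 2}"
    then have "0 < ?n" "?n - 1 < ?n" "0 < i" "i < ?n - 1" using n by auto
    then show "i \<in> {i. i < ?n \<and> (\<exists>j<?n. \<exists>k<?n. j < i \<and> i < k)}" by fastforce
  qed
  finally have U: "\<Union>{J \<in> ?O. \<exists>J1\<in>?O. \<exists>J2\<in>?O. (\<forall>x\<in>J1. \<forall>y\<in>J. x < y) \<and> (\<forall>x\<in>J. \<forall>y\<in>J2. x < y)} = U"
    unfolding U_def by (simp add: image_image)
  define h where "h = ((\<lambda>t. if t \<in> U then fst g t else t), snd g \<inter> U)"
  have circ: "circ g h' \<longleftrightarrow> h' = h" for h'
    unfolding circ_def has_frame_card_orbitals[OF g] Let_def U h_def using n by auto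
  have fx: "fst g (bp B i) = bp B i" if "i \<le> ?n" for i
    using bp_notin_cell[OF v _ that] S homeo_plus_fixed[OF hp] by auto
  have Usub: "U \<subseteq> supt (fst g)" unfolding U_def S by (force simp: less_diff_conv)
  have "U = {bp B 1..bp B (?n - 1)} \<inter> supt (fst g)"
  proof (intro equalityI subsetI)
    fix r assume r: "r \<in> U"
    then obtain i where i: "i < ?n - 2" "r \<in> cell B (Suc i)" unfolding U_def by auto
    have "bp B 1 \<le> bp B (Suc i)" "bp B (Suc (Suc i)) \<le> bp B (?n - 1)" using bp_le[OF v] i by auto
    then show "r \<in> {bp B 1..bp B (?n - 1)} \<inter> supt (fst g)" using r Usub i by auto
  next
    fix r assume r: "r \<in> {bp B 1..bp B (?n - 1)} \<inter> supt (fst g)"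
    then obtain i where i: "i < ?n" "r \<in> cell B i" using S by auto
    then have "bp B i < bp B (?n - 1)" "bp B 1 < bp B (Suc i)" using r by auto
    then have "i < ?n - 1" "1 < Suc i" using bp_less_iff[OF v] i by auto
    then have "i - 1 < ?n - 2" "i = Suc (i - 1)" by auto
    then show "r \<in> U" unfolding U_def using i(2) by (metis UN_iff core_sel(1,2) lessThan_iff)
  qed
  then have "fst h = (\<lambda>t. if t \<in> {bp B 1..bp B (?n - 1)} then fst g t else t)"
    unfolding h_def using homeo_plus_fixed[OF hp] by auto
  then have hh: "homeo_plus (fst h)" using homeo_plus_restrict[OF hp fx fx, of 1 "?n - 1"] n by simp
  have sh: "supt (fst h) = U" unfolding h_def supt_def using Usub unfolding supt_def by auto
  have mk: "mk B i \<in> cell B j \<longleftrightarrow> i = j" if "i < ?n" "j < ?n" for i j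
    using cell_disjoint[OF v that] validD[OF v that(1)] by fastforce
  have sm: "snd h = mk (core B) ` {..<?n - 2}"
  proof (intro equalityI subsetI)
    fix r assume "r \<in> snd h"
    then obtain i j where "i < ?n" "r = mk B i" "j < ?n - 2" "r \<in> cell B (Suc j)"
      unfolding h_def has_frameD(4)[OF g] U_def by auto
    then show "r \<in> mk (core B) ` {..<?n - 2}" using mk[of i "Suc j"] by auto
  next
    fix r assume "r \<in> mk (core B) ` {..<?n - 2}"
    then obtain j where j: "r = mk B (Suc j)" "j < ?n - 2" by auto
    then have "r \<in> cell (core B) j" using mk[of "Suc j" "Suc j"] by auto
    then show "r \<in> snd h" unfolding h_def has_frameD(4)[OF g] U_def using j by auto
  qed
  have "if i < (?n - 2) div 2 then (\<forall>r\<in>cell (core B) i. fst h r < r) \<and> fst h (im (core B) i) = mk (core B) i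
          else (\<forall>r\<in>cell (core B) i. fst h r > r) \<and> fst h (mk (core B) i) = im (core B) i" 
    if i: "i < ?n - 2" for i
  proof -
    \<comment> \<open>Dropping one bump at either end lowers the number of negative bumps by one, so
      the change of sign stays at the same bump.\<close>
    have e: "i < (?n - 2) div 2 \<longleftrightarrow> Suc i < ?n div 2" by auto
    have cU: "cell B (Suc i) \<subseteq> U" unfolding U_def using i by auto
    have Si: "Suc i < ?n" using i by simp
    have "mk B (Suc i) \<in> cell B (Suc i)" "im B (Suc i) \<in> cell B (Suc i)" using validD[OF v Si] by auto
    then show ?thesis using has_frame_neg[OF g, of "Suc i"] has_frame_pos[OF g, of "Suc i"] i cU unfolding e h_def by (auto simp: subset_iff)
  qed
  then have sg: "\<forall>i<?n - 2. if i < (?n - 2) div 2 then (\<forall>r\<in>cell (core B) i. fst h r < r) \<and> fst h (im (core B) i) = mk (core B) i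
          else (\<forall>r\<in>cell (core B) i. fst h r > r) \<and> fst h (mk (core B) i) = im (core B) i" by blast
  have "has_frame h (core B)"
    using valid_core[OF v n] hh sh[unfolded U_def] sm sg unfolding has_frame_def core_sel(1) by (intro conjI)
  then show ?thesis using circ by blast
qed

lemma circ_small:
  assumes g: "has_frame g B" and n: "nb B \<le> 2" and c: "circ g h"
  shows "\<exists>C. has_frame h C \<and> circ_frame B C"
proof -
  note v = has_frameD(1)[OF g]
  let ?m = "nb B - 1"
  \<comment> \<open>With one or two orbitals exactly the last bump is positive.\<close>
  have m: "?m < nb B" "\<not> ?m < nb B div 2" "\<And>i. i < nb B \<Longrightarrow> \<not> i < nb B div 2 \<Longrightarrow> i = ?m" 
    using has_frameD(5)[OF g] n by auto
  obtain J s b s' where J: "pos_orbital (fst g) J" "s \<in> snd g" "s \<in> J" and h: "h = (b, {s'})"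
    "homeo_plus b" "supt b = {Inf J<..<s}" "\<forall>t\<in>supt b. b t > t" "s' \<in> {Inf J<..<s}"
    using c n unfolding circ_def has_frame_card_orbitals[OF g] by auto
  obtain i where i: "i < nb B" "J = cell B i" using J(1) unfolding pos_orbital_def has_frame_orbitals[OF g] by auto
  have "\<not> i < nb B div 2"
    using J(1,3) has_frame_neg(1)[OF g, of i s] i unfolding pos_orbital_def by fastforce
  then have im: "i = ?m" using m i by auto
  have mk: "mk B i \<in> cell B j \<longleftrightarrow> i = j" if "i < nb B" "j < nb B" for i j
    using cell_disjoint[OF v that] validD[OF v that(1)] by fastforce
  have s: "s = mk B ?m" using J(2,3) mk i unfolding has_frameD(4)[OF g] im[symmetric] by auto
  have I: "Inf J = bp B ?m" unfolding i(2) im using validD(4)[OF v m(1)] by auto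
  let ?u = "bp B ?m" and ?w = "mk B ?m"
  have e: "b ?u = ?u" "b ?w = ?w" by (rule homeo_plus_fixed[OF h(2)]; simp add: h(3) I s)+
  have "{?u<..<?w} \<subseteq> {0..1}" using supt_subset[OF h(2)] unfolding h(3) I s by auto
  then have "b s' \<in> {?u<..<?w}" using homeo_plus_cell(1)[OF h(2) e] h(5) unfolding I s by auto
  moreover have "s' < b s'" using h by auto
  ultimately have "has_frame h (Frame 1 (\<lambda>i. if i = 0 then ?u else ?w) (\<lambda>_. s') (\<lambda>_. b s'))"
    unfolding has_frame_def valid_def using h unfolding I s by auto
  then show ?thesis using n unfolding circ_frame_def by (intro exI conjI) auto
qed

lemma circ_has_frame: assumes "has_frame g B" "circ g h" shows "\<exists>C. has_frame h C \<and> circ_frame B C"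
proof (cases "2 < nb B")
  case True
  then have "has_frame h (core B)" using circ_large[OF assms(1) True] assms(2) by metis
  then show ?thesis using True unfolding circ_frame_def by blast
next
  case False
  then show ?thesis using circ_small[OF assms(1) _ assms(2)] by simp
qed

section \<open>Oscillation and condition (!)\<close>

abbreviation lo :: "frame \<Rightarrow> real" where "lo A \<equiv> bp A 0"
abbreviation hi :: "frame \<Rightarrow> real" where "hi A \<equiv> bp A (nb A)"

definition sq :: "frame \<Rightarrow> frame \<Rightarrow> bool" where
  "sq A B \<longleftrightarrow> lo B < lo A \<and> hi A < hi B"

definition frame_osc :: "frame \<Rightarrow> frame \<Rightarrow> nat" where
  "frame_osc A B = card {j. j < nb B \<and> (\<exists>i\<le>nb A. bp A i \<in> cell B j)}"

lemma osc_frame_osc: "osc f g = int (frame_osc A B)" if "has_frame f A" "has_frame g B"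
  using has_frame_osc[OF that] unfolding frame_osc_def .

lemma lo_less_hi: "lo A < hi A" if "valid A"
  using that bp_less[OF that, of 0 "nb A"] unfolding valid_def by simp

lemma std_ll_iff: "std_ll f g \<longleftrightarrow> hi A \<le> lo B" if f: "has_frame f A" and g: "has_frame g B"
proof -
  note l = lo_less_hi[OF has_frameD(1)[OF f]] lo_less_hi[OF has_frameD(1)[OF g]]
  have "hi A \<le> lo B" if "\<forall>x\<in>{lo A<..<hi A}. \<forall>y\<in>{lo B<..<hi B}. x < y"
  proof (rule ccontr)
    assume c: "\<not> hi A \<le> lo B"
    obtain x where x: "max (lo A) (lo B) < x" "x < hi A" using dense[of "max (lo A) (lo B)" "hi A"] c l by auto
    obtain y where y: "lo B < y" "y < min x (hi B)" using dense[of "lo B" "min x (hi B)"] x l by auto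
    have "x \<in> {lo A<..<hi A}" "y \<in> {lo B<..<hi B}" using x y by auto
    then have "x < y" using that by blast
    then show False using y by simp
  qed
  then show ?thesis unfolding std_ll_def has_frame_ext_supt[OF f] has_frame_ext_supt[OF g] by fastforce
qed

lemma std_sq_iff: "std_sq f g \<longleftrightarrow> sq A B" if f: "has_frame f A" and g: "has_frame g B"
proof -
  note l = lo_less_hi[OF has_frameD(1)[OF f]]
  have "{lo A..hi A} \<subseteq> {lo B<..<hi B} \<longleftrightarrow> lo B < lo A \<and> hi A < hi B"
  proof
    assume "{lo A..hi A} \<subseteq> {lo B<..<hi B}"
    moreover have "lo A \<in> {lo A..hi A}" "hi A \<in> {lo A..hi A}" using l by auto
    ultimately have "lo A \<in> {lo B<..<hi B}" "hi A \<in> {lo B<..<hi B}" by blast+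
    then show "lo B < lo A \<and> hi A < hi B" by simp
  qed auto
  then show ?thesis unfolding std_sq_def has_frame_ext_supt[OF f] has_frame_ext_supt[OF g] sq_def using l by simp
qed

text \<open>A common breakpoint would be interior to \<open>B\<close>, so feet of \<open>B\<close>
  abut it on both sides. A foot of \<open>A\<close> abuts it too, on the left if it is the last
  breakpoint of \<open>A\<close> and on the right otherwise, and two such feet overlap.\<close>

lemma bp_ne:
  assumes d: "feet_disjoint A B" "valid A" "valid B" and s: "sq A B" and ij: "i \<le> nb A" "j \<le> nb B"
  shows "bp A i \<noteq> bp B j"
proof
  assume e: "bp A i = bp B j"
  have A: "lo A \<le> bp A i" "bp A i \<le> hi A" using bp_le[OF d(2)] ij by auto
  then have "bp B j \<noteq> hi B" "bp B j \<noteq> lo B" using s e unfolding sq_def by auto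
  then have "j \<noteq> nb B" "j \<noteq> 0" by metis+
  then have j: "j < nb B" "Suc (j - 1) = j" using ij by auto
  show False
  proof (cases "i = nb A")
    case True
    then have i: "Suc (i - 1) = i" "i - 1 < nb A" using d(2) unfolding valid_def by auto
    have j': "j - 1 < nb B" using j by simp
    show False using feet_disjointD(2)[OF d i(2) j'] validD[OF d(2) i(2)] validD[OF d(3) j'] e unfolding i(1) j(2) by auto
  next
    case False
    then have i: "i < nb A" using ij by simp
    show False using feet_disjointD(1)[OF d i j(1)] validD[OF d(2) i] validD[OF d(3) j(1)] e by auto
  qed
qed

text \<open>Each breakpoint of \<open>A\<close> starts a left foot or, if it is the last one, ends a
  right foot; strictly inside a left foot of \<open>B\<close> it would produce an overlap.\<close>

lemma bp_notin_left_foot: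
  assumes d: "feet_disjoint A B" "valid A" "valid B" and ij: "i \<le> nb A" "j < nb B"
  shows "\<not> (bp B j < bp A i \<and> bp A i < mk B j)"
proof (cases "i = nb A")
  case True
  then have i: "Suc (i - 1) = i" "i - 1 < nb A" using d(2) unfolding valid_def by auto
  show ?thesis using feet_disjointD(4)[OF d i(2) ij(2)] validD[OF d(2) i(2)] unfolding i(1) by auto
next
  case False
  then have i: "i < nb A" using ij by simp
  show ?thesis using feet_disjointD(1)[OF d i ij(2)] validD[OF d(2) i] by auto
qed

lemma mk_notin_left_foot:
  assumes d: "feet_disjoint A B" "valid A" "valid B" and ij: "i < nb A" "j < nb B"
  shows "\<not> (bp B j < mk A i \<and> mk A i < mk B j)"
  using feet_disjointD(1)[OF d ij] validD[OF d(2) ij(1)] by auto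

lemma ll_feet_disjoint: assumes v: "valid A" "valid B" and l: "hi A \<le> lo B" shows "feet_disjoint A B"
  unfolding feet_disjoint_def
proof (intro allI impI)
  fix i j assume ij: "i < nb A" "j < nb B"
  have "bp A (Suc i) \<le> bp B j" using bp_le[OF v(1), of "Suc i" "nb A"] bp_le[OF v(2), of 0 j] ij l by auto
  then have "cell A i \<inter> cell B j = {}" by auto
  then show "foot A i \<inter> foot B j = {}" using foot_subset[OF v(1) ij(1)] foot_subset[OF v(2) ij(2)] by blast
qed

section \<open>Oscillation of separated and of nested frames\<close>

lemma frame_osc_ll: assumes v: "valid A" "valid B" and l: "hi A \<le> lo B" shows "frame_osc A B = 0"
proof -
  have "bp A i \<notin> cell B j" if "i \<le> nb A" "j < nb B" for i j
    using bp_le[OF v(1), of i "nb A"] bp_le[OF v(2), of 0 j] that l by auto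
  then have e: "{j. j < nb B \<and> (\<exists>i\<le>nb A. bp A i \<in> cell B j)} = {}" by blast
  show ?thesis unfolding frame_osc_def e by simp
qed

text \<open>Facts shared by both shapes of \<open>circ_frame\<close>, so that later arguments need
  not split on the number of orbitals. With one orbital the new bump starts at the old place and the
  number of orbitals does not drop, hence the exceptions.\<close>

lemma circ_frame_lo_hi: assumes "circ_frame B C" "valid B" 
  shows "bp B (nb B - 1) \<le> hi C" "1 < nb B \<Longrightarrow> lo C = bp B 1" "nb B = 1 \<Longrightarrow> lo C = lo B"
    "\<exists>i\<le>nb B. lo C = bp B i" "nb C < nb B \<or> nb B = 1"
proof -
  have n: "0 < nb B" using assms(2) unfolding valid_def by simp
  have "nb B - 1 < nb B" using n by simp
  moreover have "Suc (nb B - 2) = nb B - 1" if "2 < nb B" using that by simp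
  ultimately show "bp B (nb B - 1) \<le> hi C"
    using assms(1) validD(1)[OF assms(2), of "nb B - 1"] unfolding circ_frame_def by (elim disjE) auto
  have "nb B - 1 = 1" if "1 < nb B" "nb B \<le> 2" using that by simp
  then show "1 < nb B \<Longrightarrow> lo C = bp B 1" using assms(1) unfolding circ_frame_def by (elim disjE) auto
  show "nb B = 1 \<Longrightarrow> lo C = lo B" using assms(1) unfolding circ_frame_def by auto
  have "1 \<le> nb B" "nb B - 1 \<le> nb B" using n by auto
  moreover have "lo C = bp B 1 \<or> lo C = bp B (nb B - 1)" using assms(1) unfolding circ_frame_def by (elim disjE) auto
  ultimately show "\<exists>i\<le>nb B. lo C = bp B i" by blast
  show "nb C < nb B \<or> nb B = 1" using assms(1) n unfolding circ_frame_def by (elim disjE) auto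
qed

lemma circ_frame_unique: assumes "circ_frame B C" "circ_frame B C'" 
  shows "nb C = nb C'" "i \<le> nb C \<Longrightarrow> bp C i = bp C' i"
proof -
  show "nb C = nb C'" using assms unfolding circ_frame_def by auto
  show "bp C i = bp C' i" if "i \<le> nb C"
  proof (cases "2 < nb B")
    case True then show ?thesis using assms unfolding circ_frame_def by auto
  next
    case False
    then have "i = 0 \<or> i = 1" using assms that unfolding circ_frame_def by auto
    then show ?thesis using False assms unfolding circ_frame_def by auto
  qed
qed

text \<open>Oscillation uses only the breakpoints of its first argument, and these are the same for
  every choice of the free marker.\<close>

lemma frame_osc_circ_frame_unique: assumes "circ_frame B C" "circ_frame B C'" shows "frame_osc C A = frame_osc C' A"
  unfolding frame_osc_def using circ_frame_unique[OF assms] by (metis (no_types, lifting))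

text \<open>The last cell of \<open>B\<close> starts at or before \<open>hi C\<close>, hence at or
  before \<open>lo A\<close>, and strictly so by \<open>bp_ne\<close>. So all breakpoints of
  \<open>A\<close> fall into that one cell.\<close>

lemma frame_osc_right_of_core:
  assumes d: "feet_disjoint A B" "valid A" "valid B" and s: "sq A B" and c: "circ_frame B C" "hi C \<le> lo A"
  shows "frame_osc A B = 1"
proof -
  let ?m = "nb B - 1"
  have m: "?m < nb B" "Suc ?m = nb B" using d(3) unfolding valid_def by auto
  have b: "bp A i \<in> cell B ?m" if i: "i \<le> nb A" for i
  proof -
    have "lo A \<le> bp A i" "bp A i \<le> hi A" using bp_le[OF d(2)] i by auto
    then show ?thesis using bp_ne[OF d s i, of ?m] m circ_frame_lo_hi(1)[OF c(1) d(3)] c(2) s unfolding sq_def by auto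
  qed
  have "{j. j < nb B \<and> (\<exists>i\<le>nb A. bp A i \<in> cell B j)} = {?m}"
  proof (intro equalityI subsetI)
    fix j assume "j \<in> {j. j < nb B \<and> (\<exists>i\<le>nb A. bp A i \<in> cell B j)}"
    then obtain i where "j < nb B" "i \<le> nb A" "bp A i \<in> cell B j" by auto
    then show "j \<in> {?m}" using b[of i] cell_disjoint[OF d(3) _ m(1), of j] by blast
  qed (use b[of 0] m in auto)
  then show ?thesis unfolding frame_osc_def by simp
qed

text \<open>The ends of \<open>A\<close> lie in the first and the last cell of \<open>B\<close>,
  which gives the 2. With more than two orbitals the remaining cells of \<open>B\<close> are those
  of \<open>C\<close>, and a breakpoint of \<open>A\<close> in one of them is not an end of
  \<open>A\<close>, hence a breakpoint of \<open>D\<close>.\<close>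

lemma frame_osc_around_core:
  assumes d: "feet_disjoint A B" "valid A" "valid B" and s: "sq A B" and c: "circ_frame B C" "sq C A" "circ_frame A D"
  shows "frame_osc A B = 2 + frame_osc D C"
proof -
  let ?m = "nb B" and ?k = "nb A"
  have pos: "0 < ?m" "0 < ?k" using d unfolding valid_def by auto
  \<comment> \<open>With one orbital, \<open>C\<close> would start where \<open>B\<close> does,
    leaving no room for the start of \<open>A\<close> between them.\<close>
  have m2: "2 \<le> ?m"
  proof (rule ccontr)
    assume "\<not> 2 \<le> ?m"
    then have "lo C = lo B" using circ_frame_lo_hi(3)[OF c(1) d(3)] pos by simp
    then show False using s c(2) unfolding sq_def by simp
  qed
  have lc: "lo C = bp B 1" using circ_frame_lo_hi(2)[OF c(1) d(3)] m2 by simp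
  have l0: "lo A \<in> cell B 0" using s c(2) lc unfolding sq_def by simp
  have Sm: "Suc (?m - 1) = ?m" using m2 by simp
  have h0: "hi A \<in> cell B (?m - 1)" 
    using s c(2) circ_frame_lo_hi(1)[OF c(1) d(3)] unfolding sq_def Sm by simp
  define T where "T = {j. j < nb C \<and> (\<exists>i\<le>nb D. bp D i \<in> cell C j)}"
  have finT: "finite T" unfolding T_def by auto
  have D: "(\<exists>i'\<le>?k. bp D i = bp A i') \<or> (bp D i = mk A (?k - 1) \<and> ?k \<le> 2)" if "i \<le> nb D" for i
  proof (cases "2 < ?k")
    case True
    then show ?thesis using c(3) that unfolding circ_frame_def by (intro disjI1 exI[of _ "Suc i"]) auto
  next
    case False
    then have "i = 0 \<or> i = 1" using c(3) that unfolding circ_frame_def by auto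
    then show ?thesis using False c(3) unfolding circ_frame_def by (metis diff_le_self)
  qed
  have k1: "?k - 1 < ?k" using pos by simp
  \<comment> \<open>Now \<open>C\<close> is supported on a left foot of \<open>B\<close>, and
    neither breakpoints nor markers of \<open>A\<close> lie inside such a foot.\<close>
  have T2: "T = {}" if m: "?m = 2"
  proof -
    have C: "nb C = 1" "bp C 0 = bp B 1" "bp C 1 = mk B 1" using c(1) m unfolding circ_frame_def by auto
    have "bp D i \<notin> cell C 0" if "i \<le> nb D" for i
      using D[OF that] bp_notin_left_foot[OF d, of _ 1] mk_notin_left_foot[OF d k1, of 1] C m by auto
    then show ?thesis unfolding T_def C(1) by (auto simp del: greaterThanLessThan_iff)
  qed
  have S: "{j. j < ?m \<and> (\<exists>i\<le>?k. bp A i \<in> cell B j)} = {0, ?m - 1} \<union> Suc ` T"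
  proof (cases "?m = 2")
    case True
    have "{j. j < ?m \<and> (\<exists>i\<le>?k. bp A i \<in> cell B j)} = {0, ?m - 1}"
    proof (intro equalityI subsetI)
      fix j assume "j \<in> {j. j < ?m \<and> (\<exists>i\<le>?k. bp A i \<in> cell B j)}"
      then have "j < 2" using True by simp
      then show "j \<in> {0, ?m - 1}" using True by (simp add: less_2_cases)
    next
      fix j assume "j \<in> {0, ?m - 1}"
      then show "j \<in> {j. j < ?m \<and> (\<exists>i\<le>?k. bp A i \<in> cell B j)}" using l0 h0 m2 by auto
    qed
    then show ?thesis using T2[OF True] by simp
  next
    case False
    then have m3: "2 < ?m" using m2 by simp
    then have C: "C = core B" using c(1) unfolding circ_frame_def by auto
    have cC: "cell C j = cell B (Suc j)" "nb C = ?m - 2" for j unfolding C by auto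
    show ?thesis
    proof (intro equalityI subsetI)
      fix j assume "j \<in> {j. j < ?m \<and> (\<exists>i\<le>?k. bp A i \<in> cell B j)}"
      then obtain i where i: "j < ?m" "i \<le> ?k" "bp A i \<in> cell B j" by auto
      show "j \<in> {0, ?m - 1} \<union> Suc ` T"
      proof (cases "j = 0 \<or> j = ?m - 1")
        case False
        have jm: "j \<noteq> 0" "j \<noteq> ?m - 1" "?m - 1 < ?m" using False pos by auto
        have "i \<noteq> 0" using i(3) l0 cell_disjoint[OF d(3) i(1) pos(1) jm(1)] by (metis disjoint_iff)
        moreover have "i \<noteq> ?k" using i(3) h0 cell_disjoint[OF d(3) i(1) jm(3,2)] by (metis disjoint_iff)
        ultimately have i0: "0 < i" "i < ?k" using i by auto
        have "\<exists>i'\<le>nb D. bp D i' = bp A i"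
        proof (cases "2 < ?k")
          case True
          then show ?thesis using c(3) i0 unfolding circ_frame_def by (intro exI[of _ "i - 1"]) auto
        next
          case False
          then have "i = ?k - 1" using i0 by auto
          then show ?thesis using c(3) False unfolding circ_frame_def by (intro exI[of _ 0]) auto
        qed
        then have "j - 1 \<in> T" unfolding T_def cC using i False by auto
        moreover have "j = Suc (j - 1)" using False by simp
        ultimately show ?thesis by blast
      qed auto
    next
      fix j assume j: "j \<in> {0, ?m - 1} \<union> Suc ` T"
      show "j \<in> {j. j < ?m \<and> (\<exists>i\<le>?k. bp A i \<in> cell B j)}"
      proof (cases "j \<in> {0, ?m - 1}")
        case True
        then show ?thesis using l0 h0 m2 by auto
      next
        case False
        then obtain j' i where ji: "j = Suc j'" "j' < ?m - 2" "i \<le> nb D" "bp D i \<in> cell B j"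
          using j unfolding T_def cC by auto
        have jm: "j < ?m" using ji by simp
        have "\<exists>i'\<le>?k. bp A i' \<in> cell B j"
          using D[OF ji(3)]
        proof (elim disjE)
          \<comment> \<open>The right end of \<open>D\<close> may be a marker of \<open>A\<close>.
            The left foot ending there must start in the same cell of \<open>B\<close>, since
            otherwise it would meet the left foot of \<open>B\<close> in that cell; its start is the
            breakpoint wanted.\<close>
          assume "bp D i = mk A (?k - 1) \<and> ?k \<le> 2"
          then have "mk A (?k - 1) \<in> cell B j" using ji by simp
          then have "bp A (?k - 1) \<in> cell B j" 
            using feet_disjointD(1)[OF d k1 jm] validD[OF d(2) k1] validD[OF d(3) jm] by auto
          then show ?thesis using k1 by (intro exI[of _ "?k - 1"]) auto
        qed (use ji in auto)
        then show ?thesis using jm by simp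
      qed
    qed
  qed
  \<comment> \<open>Keeps the shifted indices apart from \<open>?m - 1\<close>. For two orbitals
    \<open>nb C\<close> is 1 and exceeds \<open>?m - 2\<close>, but then \<open>T\<close> is
    empty.\<close>
  have "nb C \<le> ?m - 2 \<or> T = {}"
  proof (cases "?m = 2")
    case True
    then show ?thesis using T2 by simp
  next
    case False
    then show ?thesis using c(1) m2 unfolding circ_frame_def by auto
  qed
  then have "{0, ?m - 1} \<inter> Suc ` T = {}" unfolding T_def by fastforce
  then have "card ({0, ?m - 1} \<union> Suc ` T) = card {0, ?m - 1} + card (Suc ` T)"
    using finT by (intro card_Un_disjoint) auto
  also have "card {0, ?m - 1} = 2" using m2 by auto
  also have "card (Suc ` T) = card T" by (rule card_image) simp
  finally show ?thesis unfolding frame_osc_def S T_def[symmetric] .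
qed

section \<open>The rotation identity for oscillations\<close>

lemma not_ll_sq: "\<not> (hi A \<le> lo B \<and> sq A B)" if "valid A" "valid B"
  using lo_less_hi[OF that(1)] unfolding sq_def by auto

lemma sq_ne: "f \<noteq> g" if "sq A B" "has_frame f A" "has_frame g B"
  using that has_frame_ext_supt[OF that(2)] has_frame_ext_supt[OF that(3)] lo_less_hi[OF has_frameD(1)[OF that(2)]] 
    lo_less_hi[OF has_frameD(1)[OF that(3)]] unfolding sq_def by (auto simp: greaterThanLessThan_eq_iff)

lemma ll_ne: "f \<noteq> g" if "hi A \<le> lo B" "has_frame f A" "has_frame g B"
  using that has_frame_ext_supt[OF that(2)] has_frame_ext_supt[OF that(3)] lo_less_hi[OF has_frameD(1)[OF that(2)]] 
    lo_less_hi[OF has_frameD(1)[OF that(3)]] by (auto simp: greaterThanLessThan_eq_iff)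

lemma std_pair_lt: "std_pair f g \<Longrightarrow> std_ll f g \<or> std_sq f g"
  by (auto elim: std_pair.cases)

lemma std_pair_sqD:
  assumes p: "std_pair f g" and f: "has_frame f A" and g: "has_frame g B" and s: "sq A B"
  shows "fast {f, g}" "\<exists>h. circ g h \<and> std_pair h f"
proof -
  have "\<not> std_ll f g" using s std_ll_iff[OF f g] not_ll_sq has_frameD(1) f g by blast
  with p have "fast {f, g} \<and> (\<exists>h. circ g h \<and> std_pair h f)" by cases auto
  then show "fast {f, g}" "\<exists>h. circ g h \<and> std_pair h f" by auto
qed

text \<open>A derivation for a nested pair contains one for (h, f) with h a rotation of g, and the
  induction follows it. If h lies left of f, the two oscillations are 1 and 0. Otherwise
  \<open>frame_osc_around_core\<close> expresses the left side by the pair of rotated functions, to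
  which the induction hypothesis leads from (h, f).\<close>

lemma frame_osc_rotate:
  "std_pair f g \<Longrightarrow> has_frame f A \<Longrightarrow> has_frame g B \<Longrightarrow> sq A B \<Longrightarrow> circ_frame B C \<Longrightarrow> frame_osc A B = Suc (frame_osc C A)"
proof (induction arbitrary: A B C rule: std_pair.induct)
  case (ll f g)
  then show ?case using not_ll_sq std_ll_iff has_frameD(1) by blast
next
  case (sq f g h)
  obtain C' where C': "has_frame h C'" "circ_frame B C'" using circ_has_frame[OF sq(7) sq(3)] by blast
  have d: "feet_disjoint A B" using sq fast_iff sq_ne by blast
  note v = has_frameD(1)[OF sq(6)] has_frameD(1)[OF sq(7)]
  have e: "frame_osc C A = frame_osc C' A" by (rule frame_osc_circ_frame_unique[OF sq(9) C'(2)])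
  show ?case
  proof (cases "std_ll h f")
    case True
    then have l: "hi C' \<le> lo A" using std_ll_iff[OF C'(1) sq(6)] by simp
    then show ?thesis using frame_osc_right_of_core[OF d v sq(8) C'(2)] frame_osc_ll[OF has_frameD(1)[OF C'(1)] v(1)] e by simp
  next
    case False
    then have s: "sq C' A" using std_pair_lt[OF sq(4)] std_sq_iff[OF C'(1) sq(6)] by simp
    obtain e' where "circ f e'" using std_pair_sqD(2)[OF sq(4) C'(1) sq(6) s] by blast
    then obtain D where D: "circ_frame A D" using circ_has_frame[OF sq(6)] by blast
    show ?thesis using frame_osc_around_core[OF d v sq(8) C'(2) s D] sq.IH[OF C'(1) sq(6) s D] e by simp
  qed
qed

text \<open>The definition of a standard pair supplies one choice of the rotated function; every
  other choice serves as well. For at most two orbitals all choices have the same support, contained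
  in a left foot of \<open>g\<close>, so fastness with \<open>f\<close> persists.\<close>

lemma circ_std_pair:
  assumes p: "std_pair f g" and f: "has_frame f A" and g: "has_frame g B" and s: "sq A B" and c: "circ g h"
  shows "std_pair h f"
proof -
  obtain h' where fast: "fast {f, g}" and h': "circ g h'" "std_pair h' f" 
    using std_pair_sqD[OF p f g s] by blast
  note v = has_frameD(1)[OF f] has_frameD(1)[OF g]
  have d: "feet_disjoint A B" using fast fast_iff[OF f g] sq_ne[OF s f g] by blast
  show ?thesis
  proof (cases "2 < nb B")
    case True
    then show ?thesis using circ_large[OF g True] c h' by metis
  next
    case False
    obtain C where C: "has_frame h C" "circ_frame B C" using circ_has_frame[OF g c] by blast
    obtain C' where C': "has_frame h' C'" "circ_frame B C'" using circ_has_frame[OF g h'(1)] by blast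
    have e: "lo C' = lo C" "hi C' = hi C" using circ_frame_unique[OF C(2) C'(2)] by auto
    let ?m = "nb B - 1"
    have m: "?m < nb B" using v(2) unfolding valid_def by simp
    have bC: "nb C = 1" "bp C 0 = bp B ?m" "bp C (Suc 0) = mk B ?m" using C(2) False unfolding circ_frame_def by auto
    have "foot C i \<subseteq> foot B ?m" if "i < nb C" for i
      using foot_subset[OF has_frameD(1)[OF C(1)] that] that bC unfolding foot_def by auto
    then have dC: "feet_disjoint C A" using d m unfolding feet_disjoint_def by blast
    show ?thesis
      using h'(2)
    proof (cases rule: std_pair.cases)
      case ll
      then have l: "hi C \<le> lo A" using std_ll_iff[OF C'(1) f] e by simp
      then have "fast {h, f}" using fast_iff[OF C(1) f ll_ne[OF l C(1) f]] dC by simp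
      then show ?thesis using l std_ll_iff[OF C(1) f] by (intro std_pair.ll) simp_all
    next
      case (sq q)
      then have s': "sq C A" using std_sq_iff[OF C'(1) f] e unfolding sq_def by simp
      obtain D where D: "has_frame q D" "circ_frame A D" using circ_has_frame[OF f sq(3)] by blast
      obtain i where i: "i \<le> nb A" "lo D = bp A i" using circ_frame_lo_hi(4)[OF D(2) v(1)] by blast
      \<comment> \<open>\<open>q\<close> starts at a breakpoint of \<open>f\<close>, and such points
        avoid the left foot of \<open>g\<close> that supports \<open>h\<close>. So \<open>q\<close>
        lies left of \<open>h'\<close>, a relation that depends on supports only and carries over to
        \<open>h\<close>.\<close>
      have "\<not> sq D C" 
      proof
        assume sqd: "sq D C"
        have "lo D < mk B ?m" using sqd lo_less_hi[OF has_frameD(1)[OF D(1)]] bC unfolding sq_def by simp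
        moreover have "bp B ?m < lo D" using sqd bC unfolding sq_def by simp
        ultimately show False using bp_notin_left_foot[OF d v i(1) m] i(2) by simp
      qed
      then have "std_ll q h'" using std_pair_lt[OF sq(4)] std_sq_iff[OF D(1) C'(1)] e unfolding sq_def by auto
      then have l: "hi D \<le> lo C" using std_ll_iff[OF D(1) C'(1)] e by simp
      then have "fast {q, h}" 
        using fast_iff[OF D(1) C(1) ll_ne[OF l D(1) C(1)]] ll_feet_disjoint[OF has_frameD(1)[OF D(1)] has_frameD(1)[OF C(1)] l] by simp
      then have qh: "std_pair q h" using l std_ll_iff[OF D(1) C(1)] by (intro std_pair.ll) simp_all
      have "fast {h, f}" using fast_iff[OF C(1) f sq_ne[OF s' C(1) f]] dC by simp
      then show ?thesis using s' std_sq_iff[OF C(1) f] by (intro std_pair.sq[OF _ _ sq(3) qh]) auto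
    qed
  qed
qed

text \<open>Both sides say that p = q \<le> r, or q = r \<le> p - 2, or r = p - 1 \<le> q. This is
  the arithmetic of passing from a < b < c to the triple that starts with the rotated c.\<close>

lemma bang_rotate: "bang r p q \<longleftrightarrow> bang (q - 1) r (p - 1)"
  unfolding bang_def by (auto simp: min_def)

text \<open>If \<open>a\<close> and \<open>b\<close> are nested in \<open>c\<close>, the rotation
  identity and \<open>bang_rotate\<close> reduce the claim to the triple of the rotated
  \<open>c\<close>, \<open>a\<close>, \<open>b\<close>, which has fewer orbitals unless
  \<open>c\<close> has only one. Otherwise enough oscillations vanish.\<close>

lemma std_triple_bang:
  "has_frame a A \<Longrightarrow> has_frame b B \<Longrightarrow> has_frame c C \<Longrightarrow> std_pair a b \<Longrightarrow> std_pair b c \<Longrightarrow> std_pair a c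
    \<Longrightarrow> bang (int (frame_osc A B)) (int (frame_osc B C)) (int (frame_osc A C))"
proof (induction "nb A + nb B + nb C" arbitrary: a b c A B C rule: less_induct)
  case less
  note a = less.prems(1) and b = less.prems(2) and c = less.prems(3)
  note v = has_frameD(1)[OF a] has_frameD(1)[OF b] has_frameD(1)[OF c]
  have ab: "hi A \<le> lo B \<or> sq A B" using std_pair_lt[OF less.prems(4)] std_ll_iff[OF a b] std_sq_iff[OF a b] by simp
  have bc: "hi B \<le> lo C \<or> sq B C" using std_pair_lt[OF less.prems(5)] std_ll_iff[OF b c] std_sq_iff[OF b c] by simp
  have ac: "hi A \<le> lo C \<or> sq A C" using std_pair_lt[OF less.prems(6)] std_ll_iff[OF a c] std_sq_iff[OF a c] by simp
  consider "hi B \<le> lo C" | "sq B C" "hi A \<le> lo C" | "sq B C" "sq A C" using bc ac by blast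
  then show ?case
  proof cases
    case 1
    have "hi A \<le> lo C" using ab 1 lo_less_hi[OF v(2)] unfolding sq_def by auto
    then have "frame_osc B C = 0" "frame_osc A C = 0" using frame_osc_ll v 1 by auto
    then show ?thesis unfolding bang_def by simp
  next
    case 2
    have "hi A \<le> lo B" using 2 unfolding sq_def by simp
    \<comment> \<open>Here r = q = 0, and the rotation identity gives p \<ge> 1, so that min (p - 1)
      q is 0.\<close>
    then have "frame_osc A B = 0" "frame_osc A C = 0" using frame_osc_ll v 2 by auto
    moreover obtain h where "circ c h" 
      using std_pair_sqD(2)[OF less.prems(5) b c 2(1)] by blast
    moreover from this obtain D where "circ_frame C D" using circ_has_frame[OF c] by blast
    ultimately show ?thesis using frame_osc_rotate[OF less.prems(5) b c 2(1)] unfolding bang_def by fastforce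
  next
    case 3
    obtain h where h: "circ c h" 
      using std_pair_sqD(2)[OF less.prems(5) b c 3(1)] by blast
    obtain D where D: "has_frame h D" "circ_frame C D" using circ_has_frame[OF c h] by blast
    note ha = circ_std_pair[OF less.prems(6) a c 3(2) h] and hb = circ_std_pair[OF less.prems(5) b c 3(1) h]
    have o: "frame_osc A C = Suc (frame_osc D A)" "frame_osc B C = Suc (frame_osc D B)"
      using frame_osc_rotate less.prems 3 D(2) by blast+
    show ?thesis
    \<comment> \<open>With one orbital the number of orbitals does not drop. But the rotated
      function starts where \<open>c\<close> does, hence lies left of \<open>a\<close> and
      \<open>b\<close>, so that p = q = 1.\<close>
    proof (cases "nb C = 1")
      case True
      then have lD: "lo D = lo C" using circ_frame_lo_hi(3)[OF D(2) v(3)] by simp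
      have "hi D \<le> lo A" using std_pair_lt[OF ha] lD std_ll_iff[OF D(1) a] std_sq_iff[OF D(1) a] 3 unfolding sq_def by simp
      moreover have "hi D \<le> lo B" using std_pair_lt[OF hb] lD std_ll_iff[OF D(1) b] std_sq_iff[OF D(1) b] 3 unfolding sq_def by simp
      ultimately have "frame_osc D A = 0" "frame_osc D B = 0" using frame_osc_ll v has_frameD(1)[OF D(1)] by auto
      then show ?thesis unfolding o bang_def by simp
    next
      case False
      then have "nb D < nb C" using circ_frame_lo_hi(5)[OF D(2) v(3)] by simp
      then have "bang (int (frame_osc D A)) (int (frame_osc A B)) (int (frame_osc D B))"
        using less.hyps[OF _ D(1) a b ha less.prems(4) hb] by simp
      then show ?thesis using bang_rotate[of "int (frame_osc A B)" "int (frame_osc B C)" "int (frame_osc A C)"] o by simp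
    qed
  qed
qed

section \<open>Rotation of signatures\<close>

lemma std_lt_iff: "std_lt f g \<longleftrightarrow> hi A \<le> lo B \<or> sq A B" if "has_frame f A" "has_frame g B"
  unfolding std_lt_def std_ll_iff[OF that] std_sq_iff[OF that] ..

lemma std_lt_asym: "\<not> std_lt g f" if s: "standard f" "standard g" "std_lt f g"
proof -
  obtain A where A: "has_frame f A" using standard_has_frame[OF s(1)] by blast
  obtain B where B: "has_frame g B" using standard_has_frame[OF s(2)] by blast
  note AB = A B
  show ?thesis using s(3) lo_less_hi[OF has_frameD(1)[OF AB(1)]] lo_less_hi[OF has_frameD(1)[OF AB(2)]]
    unfolding std_lt_iff[OF AB] std_lt_iff[OF AB(2,1)] sq_def by auto
qed

text \<open>By asymmetry of \<open>std_lt\<close>, an increasing enumeration also reflects the order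
  and is injective.\<close>

lemma pf_equivI:
  fixes n :: nat
  assumes "\<And>i. i < n \<Longrightarrow> standard (e i)" "A = e ` {0..<n}"
    and "\<And>i j. i < j \<Longrightarrow> j < n \<Longrightarrow> std_lt (e i) (e j) \<and> osc (e i) (e j) = G i j"
  shows "pf_equiv {0..<n} (<) G A std_lt osc"
proof -
  have lt: "std_lt (e i) (e j) \<longleftrightarrow> i < j" if "i < n" "j < n" for i j
  proof (cases i j rule: linorder_cases)
    case less then show ?thesis using assms(3)[OF less that(2)] by simp
  next
    case equal then show ?thesis using std_lt_asym[OF assms(1)[OF that(1)] assms(1)[OF that(1)]] by auto
  next
    case greater then show ?thesis
      using assms(3)[OF greater that(1)] std_lt_asym[OF assms(1)[OF that(2)] assms(1)[OF that(1)]] by auto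
  qed
  then have "inj_on e {0..<n}" 
    by (intro inj_onI) (metis atLeastLessThan_iff less_irrefl nat_neq_iff)
  then have "bij_betw e {0..<n} A" unfolding bij_betw_def assms(2) by simp
  then show ?thesis unfolding pf_equiv_def using lt assms(3) by (intro exI[of _ e]) auto
qed

text \<open>\<open>k\<close> is where the last indecomposable summand starts: \<open>zero\<close>
  makes a positive \<open>k\<close> a split, and a split at a later \<open>k'\<close> would put a 0
  at (k' - 1, n - 1), against \<open>pos\<close>. For k = n - 1 this summand is a singleton, whose
  rotation is empty.\<close>

lemma pf_rot_eq:
  assumes n: "1 < n" and k: "k < n" and pos: "\<And>i. k \<le> i \<Longrightarrow> i < n - 1 \<Longrightarrow> G i (n - 1) \<noteq> 0"
    and zero: "\<And>i j. i < k \<Longrightarrow> k \<le> j \<Longrightarrow> j < n \<Longrightarrow> G i j = 0"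
  shows "fst (pf_rot (n, G)) = (if k = n - 1 then n - 1 else n)"
    and "i < j \<Longrightarrow> j < fst (pf_rot (n, G)) \<Longrightarrow> snd (pf_rot (n, G)) i j = (if j < k then G i j else if i < k then 0 
        else if i = k then G (j - 1) (n - 1) - 1 else G (i - 1) (j - 1))"
proof -
  have le: "k' \<le> k" if "pf_splits (n, G) k'" for k'
  proof (rule ccontr)
    assume c: "\<not> k' \<le> k"
    then have "G (k' - 1) (n - 1) = 0" using that n unfolding pf_splits_def by auto
    moreover have "k' < n" using that unfolding pf_splits_def by simp
    then have "k \<le> k' - 1" "k' - 1 < n - 1" using c by linarith+
    ultimately show False using pos[of "k' - 1"] by blast
  qed
  have split: "pf_splits (n, G) k" if "0 < k" using that k zero unfolding pf_splits_def by auto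
  let ?Y = "pf_rot_indec (n - k, \<lambda>i j. G (i + k) (j + k))"
  have rot: "pf_rot (n, G) = (if k = 0 then pf_rot_indec (n, G) else pf_plus (k, G) ?Y)"
  proof (cases "k = 0")
    case True
    then have "\<not> (\<exists>k'. pf_splits (n, G) k')" using le unfolding pf_splits_def by fastforce
    then show ?thesis unfolding pf_rot_def using n True by auto
  next
    case False
    have "(GREATEST k. pf_splits (n, G) k) = k" using split False le by (intro Greatest_equality) auto
    then show ?thesis unfolding pf_rot_def Let_def using n False split by auto
  qed
  show "fst (pf_rot (n, G)) = (if k = n - 1 then n - 1 else n)"
    unfolding rot pf_rot_indec_def pf_plus_def using n k by auto
  then show "i < j \<Longrightarrow> j < fst (pf_rot (n, G)) \<Longrightarrow> snd (pf_rot (n, G)) i j = (if j < k then G i j else if i < k then 0 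
        else if i = k then G (j - 1) (n - 1) - 1 else G (i - 1) (j - 1))"
    unfolding rot pf_rot_indec_def pf_plus_def using n k by (auto simp: not_less split: if_splits)
qed

text \<open>The elements left of the greatest one form an initial segment, and its size
  \<open>k\<close> is the start of the last indecomposable summand. All further elements are nested
  in the greatest one, and the rotated function becomes the least among them.\<close>

lemma signature_rotation:
  assumes A: "A \<in> \<S>" and eq: "pf_equiv {0..<n} (<) G A std_lt osc" and rot: "set_rotation A A'"
  shows "pf_equiv {0..<fst (pf_rot (n, G))} (<) (snd (pf_rot (n, G))) A' std_lt osc"
proof -
  obtain e where e: "bij_betw e {0..<n} A" and lt0: "\<forall>i\<in>{0..<n}. \<forall>j\<in>{0..<n}. i < j \<longleftrightarrow> std_lt (e i) (e j)"
    and G0: "\<forall>i\<in>{0..<n}. \<forall>j\<in>{0..<n}. i < j \<longrightarrow> osc (e i) (e j) = G i j"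
    using eq unfolding pf_equiv_def by blast
  have lt: "i < j \<longleftrightarrow> std_lt (e i) (e j)" if "i < n" "j < n" for i j
    using lt0 that by (meson atLeastLessThan_iff le0)
  have G: "osc (e i) (e j) = G i j" if "i < j" "j < n" for i j
    using G0 that by (meson atLeastLessThan_iff le0 less_trans)
  obtain m where m: "m \<in> A" "\<And>a. a \<in> A - {m} \<Longrightarrow> std_lt a m" 
    and A': "if \<exists>a\<in>A - {m}. osc a m > 0 then \<exists>h. circ m h \<and> A' = (A - {m}) \<union> {h} else A' = A - {m}"
    using rot unfolding set_rotation_def by blast
  have img: "A = e ` {0..<n}" and inj: "inj_on e {0..<n}" using e unfolding bij_betw_def by auto
  have n0: "0 < n" using m(1) img by auto
  have em: "e (n - 1) = m"
  proof (rule ccontr)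
    assume c: "e (n - 1) \<noteq> m"
    then have s: "std_lt (e (n - 1)) m" using m(2) img n0 by auto
    obtain i where i: "i < n" "m = e i" using m(1) img by auto
    then have "n - 1 < i" using s lt n0 by simp
    then show False using i by simp
  qed
  have Am: "A - {m} = e ` {0..<n - 1}"
  proof -
    have "{0..<n} = insert (n - 1) {0..<n - 1}" using n0 by auto
    then have "A = insert m (e ` {0..<n - 1})" using img em by auto
    moreover have "m \<notin> e ` {0..<n - 1}" using inj em n0 by (force dest: inj_onD)
    ultimately show ?thesis by blast
  qed
  have std: "standard (e i)" if "i < n" for i using A img that unfolding std_sets_def by auto
  have pair: "std_pair (e i) (e j)" if "i < j" "j < n" for i j
    using A img that lt[of i j] unfolding std_sets_def by auto
  define F where "F = (\<lambda>i. SOME X. has_frame (e i) X)"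
  have F: "has_frame (e i) (F i)" if "i < n" for i
    unfolding F_def using someI_ex[OF standard_has_frame[OF std[OF that]]] .
  have v: "valid (F i)" if "i < n" for i using has_frameD(1)[OF F[OF that]] .
  have rel: "hi (F i) \<le> lo (F j) \<or> sq (F i) (F j)" if "i < j" "j < n" for i j
    using lt[of i j] std_lt_iff[OF F F, of i j] that by auto
  let ?N = "n - 1"
  \<comment> \<open>Vanishing oscillation characterizes separation, because a nested pair has
    oscillation at least 1 by the rotation identity.\<close>
  have oscN: "osc (e i) m = 0 \<longleftrightarrow> hi (F i) \<le> lo (F ?N)" and posN: "osc (e i) m \<ge> 0" if i: "i < ?N" for i
  proof -
    have in': "i < n" "?N < n" "i < ?N" using i by auto
    show "osc (e i) m \<ge> 0" unfolding osc_def by simp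
    show "osc (e i) m = 0 \<longleftrightarrow> hi (F i) \<le> lo (F ?N)"
    proof
      assume z: "osc (e i) m = 0"
      show "hi (F i) \<le> lo (F ?N)"
      proof (rule ccontr)
        assume "\<not> hi (F i) \<le> lo (F ?N)"
        then have s: "sq (F i) (F ?N)" using rel in' by blast
        obtain h where "circ (e ?N) h" using std_pair_sqD(2)[OF pair[OF in'(3,2)] F[OF in'(1)] F[OF in'(2)] s] by blast
        then obtain D where "circ_frame (F ?N) D" using circ_has_frame[OF F[OF in'(2)]] by blast
        then show False using frame_osc_rotate[OF pair[OF in'(3,2)] F[OF in'(1)] F[OF in'(2)] s] z 
            osc_frame_osc[OF F[OF in'(1)] F[OF in'(2)]] em by simp
      qed
    next
      assume "hi (F i) \<le> lo (F ?N)"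
      then show "osc (e i) m = 0" using frame_osc_ll[OF v[OF in'(1)] v[OF in'(2)]] osc_frame_osc[OF F[OF in'(1)] F[OF in'(2)]] em by simp
    qed
  qed
  define L where "L = {i. i < ?N \<and> hi (F i) \<le> lo (F ?N)}"
  define k where "k = card L"
  have "L = {..<k}" unfolding k_def
  proof (rule initial_segment)
    show "finite L" unfolding L_def by simp
    fix i j assume ij: "i \<in> L" "j < i"
    then have i: "i < ?N" "j < ?N" "hi (F i) \<le> lo (F ?N)" unfolding L_def by auto
    have "hi (F j) \<le> lo (F i) \<or> sq (F j) (F i)" using rel ij(2) i by simp
    moreover have "lo (F i) < hi (F i)" using lo_less_hi v i by simp
    ultimately have "hi (F j) \<le> lo (F ?N)" using i(3) unfolding sq_def by linarith
    then show "j \<in> L" using i unfolding L_def by simp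
  qed
  then have L: "i < k \<longleftrightarrow> i < ?N \<and> hi (F i) \<le> lo (F ?N)" for i unfolding L_def by blast
  have kn: "k \<le> ?N" using L[of ?N] by simp
  then have kn': "k < n" using n0 by linarith
  have sqN: "sq (F i) (F ?N)" if "k \<le> i" "i < ?N" for i
    using that L[of i] rel[of i ?N] by auto
  \<comment> \<open>An element nested in the greatest one starts after it, hence after everything
    that lies left of the greatest one.\<close>
  have ll: "hi (F i) \<le> lo (F j)" if ij: "i < k" "k \<le> j" "j < n" for i j
  proof (cases "j = ?N")
    case True then show ?thesis using L ij by blast
  next
    case False
    then have "lo (F ?N) < lo (F j)" using sqN[of j] ij unfolding sq_def by simp
    moreover have "hi (F i) \<le> lo (F ?N)" using L ij by blast
    ultimately show ?thesis by linarith
  qed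
  have G0: "G i j = 0" if ij: "i < k" "k \<le> j" "j < n" for i j
  proof -
    have "i < j" "i < n" using ij by auto
    then show ?thesis using G[of i j] osc_frame_osc[OF F F, of i j] frame_osc_ll[OF v v ll[OF ij], of] ij by simp
  qed
  have Gpos: "G i ?N \<noteq> 0" if "k \<le> i" "i < ?N" for i
    using oscN[OF that(2)] G[of i ?N] L[of i] that em by auto
  have ex: "(\<exists>a\<in>A - {m}. osc a m > 0) \<longleftrightarrow> k < ?N"
  proof
    assume "\<exists>a\<in>A - {m}. osc a m > 0"
    then obtain i where "i < ?N" "osc (e i) m > 0" unfolding Am by auto
    then show "k < ?N" using L[of i] oscN[of i] by auto
  next
    assume "k < ?N"
    then have "osc (e k) m > 0" using oscN[of k] posN[of k] L[of k] by auto
    then show "\<exists>a\<in>A - {m}. osc a m > 0" unfolding Am using \<open>k < ?N\<close> by auto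
  qed
  show ?thesis
  proof (cases "k = ?N")
    case kN: True
    then have A': "A' = e ` {0..<?N}" using A' ex Am by simp
    show ?thesis
    proof (cases "1 < n")
      case True
      note r = pf_rot_eq[where G = G, OF True kn' Gpos G0]
      have f: "fst (pf_rot (n, G)) = ?N" using r(1) kN kn n0 by simp
      show ?thesis unfolding f
      proof (rule pf_equivI[OF _ A'])
        fix i j assume ij: "i < j" "j < ?N"
        then show "std_lt (e i) (e j) \<and> osc (e i) (e j) = snd (pf_rot (n, G)) i j"
          using r(2)[of i j] lt[of i j] G[of i j] f kN n0 by auto
      qed (use std in auto)
    next
      case False
      then have "?N = 0" by simp
      then have "A' = {}" using A' by simp
      moreover have "fst (pf_rot (n, G)) = 0" unfolding pf_rot_def using False by auto
      ultimately show ?thesis unfolding pf_equiv_def by (auto simp: bij_betw_def)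
    qed
  next
    case False
    then have kN: "k < ?N" using kn by simp
    then obtain h where h: "circ m h" and A': "A' = e ` {0..<?N} \<union> {h}" using A' ex Am by auto
    have n1: "1 < n" using kN by simp
    note r = pf_rot_eq[where G = G, OF n1 kn' Gpos G0]
    have f: "fst (pf_rot (n, G)) = n" using r(1) kN by auto
    have Nn: "?N < n" using n0 by simp
    obtain D where D: "has_frame h D" "circ_frame (F ?N) D" using circ_has_frame[OF F[OF Nn]] h em by blast
    \<comment> \<open>The rotated function takes place \<open>k\<close>, after the elements left of
      \<open>m\<close>; those nested in \<open>m\<close> move up by one.\<close>
    define e' where "e' = (\<lambda>i. if i < k then e i else if i = k then h else e (i - 1))"
    have loD: "lo (F ?N) \<le> lo D" using circ_frame_lo_hi(4)[OF D(2) v[OF Nn]] bp_le[OF v[OF Nn], of 0] by auto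
    show ?thesis unfolding f
    proof (rule pf_equivI)
      show "standard (e' i)" if "i < n" for i using that std has_frame_standard[OF D(1)] unfolding e'_def by auto
      have "{0..<?N} = {0..<k} \<union> (\<lambda>i. i - 1) ` {Suc k..<n}"
      proof (intro equalityI subsetI)
        fix i assume i: "i \<in> {0..<?N}"
        show "i \<in> {0..<k} \<union> (\<lambda>i. i - 1) ` {Suc k..<n}"
        proof (cases "i < k")
          case False
          then have "i = Suc i - 1" "Suc i \<in> {Suc k..<n}" using i by auto
          then show ?thesis by blast
        qed auto
      qed (use kN in auto)
      then have "e ` {0..<?N} \<union> {h} = e ` {0..<k} \<union> (\<lambda>i. e (i - 1)) ` {Suc k..<n} \<union> {h}"
        by (simp add: image_Un image_image)
      also have "\<dots> = e' ` {0..<k} \<union> e' ` {Suc k..<n} \<union> e' ` {k}" unfolding e'_def by auto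
      also have "\<dots> = e' ` {0..<n}"
      proof -
        have "{0..<n} = {0..<k} \<union> {Suc k..<n} \<union> {k}" using kN by auto
        then show ?thesis by (simp only: image_Un)
      qed
      finally show "A' = e' ` {0..<n}" using A' by simp
      fix i j assume ij: "i < j" "j < n"
      have R: "snd (pf_rot (n, G)) i j = (if j < k then G i j else if i < k then 0 
        else if i = k then G (j - 1) ?N - 1 else G (i - 1) (j - 1))" using r(2)[of i j] ij f kN by auto
      consider "j < k" | "i < k" "j = k" | "i < k" "k < j" | "i = k" "k < j" | "k < i" using ij by linarith
      then show "std_lt (e' i) (e' j) \<and> osc (e' i) (e' j) = snd (pf_rot (n, G)) i j"
      proof cases
        case 1
        then show ?thesis unfolding R e'_def using ij lt[of i j] G[of i j] by auto
      next
        case 2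
        have i: "i < n" using 2 ij by simp
        have "hi (F i) \<le> lo D" using L[of i] 2(1) loD by auto
        then show ?thesis unfolding R e'_def 
          using 2 std_lt_iff[OF F[OF i] D(1)] osc_frame_osc[OF F[OF i] D(1)] frame_osc_ll[OF v[OF i] has_frameD(1)[OF D(1)]] by simp
      next
        case 3
        have i: "i < n" "j - 1 < n" using 3 ij by auto
        have "hi (F i) \<le> lo (F (j - 1))" using ll[of i "j - 1"] 3 ij by simp
        then show ?thesis unfolding R e'_def 
          using 3 std_lt_iff[OF F[OF i(1)] F[OF i(2)]] osc_frame_osc[OF F[OF i(1)] F[OF i(2)]] frame_osc_ll[OF v[OF i(1)] v[OF i(2)]] by simp
      next
        case 4
        have i: "j - 1 < n" "j - 1 < ?N" "k \<le> j - 1" using 4 ij by auto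
        note s = sqN[OF i(3,2)] and p = pair[OF i(2) Nn]
        have "std_pair h (e (j - 1))" using circ_std_pair[OF p F[OF i(1)] F[OF Nn] s] h em by simp
        then have "std_lt h (e (j - 1))" using std_pair_lt unfolding std_lt_def by blast
        moreover have "osc h (e (j - 1)) = G (j - 1) ?N - 1"
          using frame_osc_rotate[OF p F[OF i(1)] F[OF Nn] s D(2)] osc_frame_osc[OF D(1) F[OF i(1)]] 
            osc_frame_osc[OF F[OF i(1)] F[OF Nn]] G[OF i(2) Nn] by simp
        ultimately show ?thesis unfolding R e'_def using 4 by simp
      next
        case 5
        then have "i - 1 < j - 1" "j - 1 < n" "i - 1 < n" using ij by auto
        then show ?thesis unfolding R e'_def using 5 ij lt[of "i - 1" "j - 1"] G[of "i - 1" "j - 1"] by auto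
      qed
    qed
  qed
qed

lemma signature_bang:
  fixes B :: "'a::linorder set"
  assumes A: "A \<in> \<S>" and eq: "pf_equiv B (<) F A std_lt osc"
  shows "bang_cond B (<) F"
  unfolding bang_cond_def
proof (intro ballI impI)
  fix a b c assume abc: "a \<in> B" "b \<in> B" "c \<in> B" "a < b \<and> b < c"
  obtain h where h: "bij_betw h B A" and lt: "\<forall>a\<in>B. \<forall>b\<in>B. a < b \<longleftrightarrow> std_lt (h a) (h b)"
    and F: "\<forall>a\<in>B. \<forall>b\<in>B. a < b \<longrightarrow> osc (h a) (h b) = F a b"
    using eq unfolding pf_equiv_def by blast
  have hA: "h a \<in> A" "h b \<in> A" "h c \<in> A" using abc h bij_betwE by blast+
  have std: "standard f" if "f \<in> A" for f using A that unfolding std_sets_def by blast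
  have pair: "std_pair f g" if "f \<in> A" "g \<in> A" "std_lt f g" for f g
    using A that unfolding std_sets_def by blast
  obtain X Y Z where X: "has_frame (h a) X" and Y: "has_frame (h b) Y" and Z: "has_frame (h c) Z" 
    using standard_has_frame std hA by meson
  have ac: "a < c" using abc by auto
  have "std_lt (h a) (h b)" "std_lt (h b) (h c)" "std_lt (h a) (h c)" using lt abc ac by blast+
  then have "bang (int (frame_osc X Y)) (int (frame_osc Y Z)) (int (frame_osc X Z))"
    using std_triple_bang[OF X Y Z] pair hA by blast
  then show "bang (F a b) (F b c) (F a c)"
    using F abc ac osc_frame_osc[OF X Y] osc_frame_osc[OF Y Z] osc_frame_osc[OF X Z] by metis
qed

section \<open>Realizing frames\<close>

lemma homeo_plus_extend:
  assumes c: "continuous_on {u..v} f" and m: "strict_mono_on {u..v} f" and e: "f u = u" "f v = v"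
    and uv: "0 \<le> u" "u \<le> v" "v \<le> 1"
  shows "homeo_plus (\<lambda>t. if t \<le> u then t else if t \<le> v then f t else t)"
proof (rule homeo_plusI)
  have 1: "continuous_on ({u..v} \<union> {v..1}) (\<lambda>t. if t \<le> v then f t else t)"
    by (rule continuous_on_If) (use c e in \<open>auto intro: continuous_intros\<close>)
  have "continuous_on ({0..u} \<union> ({u..v} \<union> {v..1})) (\<lambda>t. if t \<le> u then t else if t \<le> v then f t else t)"
  proof (rule continuous_on_If)
    fix t assume "t \<in> {u..v} \<union> {v..1}" "t \<le> u"
    then have "t = u" using uv by auto
    then show "t = (if t \<le> v then f t else t)" using uv e by simp
  qed (use 1 uv in auto)
  moreover have "{0..u} \<union> ({u..v} \<union> {v..1}) = {0..1}" using uv by auto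
  ultimately show "continuous_on {0..1} (\<lambda>t. if t \<le> u then t else if t \<le> v then f t else t)" by simp
  show "strict_mono_on {0..1} (\<lambda>t. if t \<le> u then t else if t \<le> v then f t else t)"
  proof (rule strict_mono_onI)
    fix r s :: real assume rs: "r \<in> {0..1}" "s \<in> {0..1}" "r < s"
    have "u < f t \<and> f t \<le> v" if "u < t" "t \<le> v" for t
      using strict_mono_onD[OF m, of u t] strict_mono_on_leD[OF m, of t v] that e by auto
    then show "(if r \<le> u then r else if r \<le> v then f r else r) < (if s \<le> u then s else if s \<le> v then f s else s)"
      using strict_mono_onD[OF m, of r s] rs by (smt (verit) atLeastAtMost_iff)
  qed
  show "(if t \<le> u then t else if t \<le> v then f t else t) = t" if "t \<notin> {0<..<1}" for t
  proof -
    have "t \<le> u \<or> t = v \<or> v < t" using uv that by force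
    then show ?thesis using e by auto
  qed
qed

text \<open>The bump is the Moebius map fixing the endpoints, written in the coordinate
  \<open>(t - u) / (v - t)\<close>, where it is multiplication by \<open>c\<close>.\<close>

lemma bump_exists:
  fixes u v p q :: real
  assumes uv: "0 \<le> u" "v \<le> 1" and p: "u < p" "p < v" and q: "u < q" "q < v" and "p \<noteq> q"
  shows "\<exists>f. homeo_plus f \<and> supt f = {u<..<v} \<and> f p = q
     \<and> (if p < q then \<forall>r\<in>{u<..<v}. r < f r else \<forall>r\<in>{u<..<v}. f r < r)"
proof -
  \<comment> \<open>The quotient of the coordinates of \<open>q\<close> and \<open>p\<close>, so
    that \<open>p\<close> goes to \<open>q\<close>; \<open>d\<close> is the denominator that appears
    on returning from the coordinate to [u, v].\<close>
  define c where "c = ((q - u) * (v - p)) / ((v - q) * (p - u))"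
  define d where "d = (\<lambda>r. (v - r) + c * (r - u))"
  define f where "f = (\<lambda>r. u + (v - u) * (c * (r - u)) / d r)"
  define g where "g = (\<lambda>t. if t \<le> u then t else if t \<le> v then f t else t)"
  have c: "0 < c" unfolding c_def using p q by simp
  have d: "0 < d r" if "u \<le> r" "r \<le> v" for r
  proof (cases "r = u")
    case True then show ?thesis unfolding d_def using p by simp
  next
    case False
    then have "0 < c * (r - u)" using c that by simp
    then show ?thesis unfolding d_def using that by simp
  qed
  have e: "f u = u" "f v = v" using d[of v] p c unfolding f_def d_def by auto
  have "strict_mono_on {u..v} f"
  proof (rule strict_mono_onI)
    fix r s assume rs: "r \<in> {u..v}" "s \<in> {u..v}" "r < s"
    have "c * (s - u) * d r - c * (r - u) * d s = c * ((v - u) * (s - r))"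
      unfolding d_def by (simp add: algebra_simps)
    moreover have "0 < c * ((v - u) * (s - r))" using c rs p by simp
    ultimately have "c * (r - u) * d s < c * (s - u) * d r" by simp
    then have "c * (r - u) / d r < c * (s - u) / d s" using d rs by (simp add: divide_simps)
    then have "(v - u) * (c * (r - u) / d r) < (v - u) * (c * (s - u) / d s)" 
      using p by (intro mult_strict_left_mono) auto
    then show "f r < f s" unfolding f_def by simp
  qed
  moreover have "continuous_on {u..v} f" unfolding f_def
  proof (intro continuous_intros)
    show "continuous_on {u..v} d" unfolding d_def by (intro continuous_intros)
    show "\<forall>x\<in>{u..v}. d x \<noteq> 0" using d by force
  qed
  ultimately have h: "homeo_plus g" unfolding g_def using homeo_plus_extend[of u v f] e uv p by simp
  \<comment> \<open>The displacement has the sign of c - 1 on the whole open interval, so all its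
    points move the same way as \<open>p\<close>.\<close>
  have diff: "f r - r = (c - 1) * ((r - u) * (v - r)) / d r" if "u \<le> r" "r \<le> v" for r
  proof -
    have "f r - r = (u * d r + (v - u) * (c * (r - u)) - r * d r) / d r"
      using d[OF that] unfolding f_def by (simp add: field_simps)
    also have "u * d r + (v - u) * (c * (r - u)) - r * d r = (c - 1) * ((r - u) * (v - r))"
      unfolding d_def by (simp add: algebra_simps)
    finally show ?thesis .
  qed
  have fp: "f p = q"
  proof -
    have nz: "v - q \<noteq> 0" "p - u \<noteq> 0" "v - u \<noteq> 0" "v - p \<noteq> 0" using p q by auto
    have cp: "c * (p - u) = (q - u) * (v - p) / (v - q)" unfolding c_def using nz by simp
    have dp: "d p = (v - p) * (v - u) / (v - q)"
      unfolding d_def cp using nz by (simp add: field_simps)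
    have "a * (x * b / w) / (b * a / w) = x" if "a \<noteq> 0" "b \<noteq> 0" "w \<noteq> 0" for a b w x :: real
      using that by simp
    then have "(v - u) * (c * (p - u)) / d p = q - u" unfolding dp cp using nz by blast
    then show ?thesis unfolding f_def by simp
  qed
  have quot: "0 < (r - u) * (v - r) / d r" if "u < r" "r < v" for r using d[of r] that by simp
  have "q - p = (c - 1) * ((p - u) * (v - p) / d p)" using diff[of p] fp p by simp
  then have sgn: "p < q \<longleftrightarrow> 1 < c" "q < p \<longleftrightarrow> c < 1"
    using quot[OF p] by (metis diff_gt_0_iff_gt zero_less_mult_pos2 mult_pos_pos, metis diff_less_0_iff_less mult_less_0_iff less_asym)
  have in_uv: "g r = f r" if "u < r" "r < v" for r unfolding g_def using that by simp
  have out_uv: "g r = r" if "\<not> (u < r \<and> r < v)" for r unfolding g_def using that e by auto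
  have up: "r < g r" if "p < q" "u < r" "r < v" for r
    using diff[of r] quot[of r] in_uv that sgn(1) by (smt (verit) mult_pos_pos times_divide_eq_right)
  have down: "g r < r" if "\<not> p < q" "u < r" "r < v" for r
    using diff[of r] quot[of r] in_uv that sgn(2) \<open>p \<noteq> q\<close> by (smt (verit) mult_neg_pos times_divide_eq_right)
  have "supt g = {u<..<v}"
  proof (intro equalityI subsetI)
    fix r assume "r \<in> supt g" then show "r \<in> {u<..<v}" using out_uv unfolding supt_def by auto
  next
    fix r assume r: "r \<in> {u<..<v}"
    then have "g r \<noteq> r" using up[of r] down[of r] by fastforce
    then show "r \<in> supt g" unfolding supt_def using r uv by auto
  qed
  moreover have "g p = q" using in_uv[OF p] fp by simp
  ultimately show ?thesis using h up down by (intro exI[of _ g]) auto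
qed

definition frame_pts :: "frame \<Rightarrow> real set" where
  "frame_pts A = bp A ` {..nb A} \<union> mk A ` {..<nb A} \<union> im A ` {..<nb A}"

text \<open>Bumps are glued on from left to right, both maps fixing the joint. A negative bump is
  obtained by sending \<open>im\<close> to \<open>mk\<close>, a positive one by sending
  \<open>mk\<close> to \<open>im\<close>.\<close>

lemma has_frame_exists:
  assumes v: "valid A" and sub: "bp A ` {..nb A} \<subseteq> {0..1}"
  shows "\<exists>f. has_frame f A"
proof -
  define C where "C = (\<lambda>f i. if i < nb A div 2
          then (\<forall>r\<in>cell A i. f r < r) \<and> f (im A i) = mk A i
          else (\<forall>r\<in>cell A i. f r > r) \<and> f (mk A i) = im A i)"
  have "\<exists>f. homeo_plus f \<and> supt f = (\<Union>i<n. cell A i) \<and> (\<forall>i<n. C f i)" if "n \<le> nb A" for n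
    using that
  proof (induction n)
    case 0
    show ?case by (intro exI[of _ "\<lambda>t. t"]) (auto simp: homeo_plus_id supt_def)
  next
    case (Suc n)
    then obtain f where f: "homeo_plus f" "supt f = (\<Union>i<n. cell A i)" "\<forall>i<n. C f i" by auto
    have n: "n < nb A" using Suc by simp
    note vn = validD[OF v n]
    have "bp A n \<in> {0..1}" "bp A (Suc n) \<in> {0..1}" using sub[THEN subsetD, OF imageI] n by simp_all
    then have b01: "0 \<le> bp A n" "bp A (Suc n) \<le> 1" by auto
    obtain g where g: "homeo_plus g" "supt g = cell A n" "C g n"
    proof (cases "n < nb A div 2")
      case True
      then show ?thesis using bump_exists[OF b01, of "im A n" "mk A n"] vn that unfolding C_def by fastforce
    next
      case False
      then show ?thesis using bump_exists[OF b01, of "mk A n" "im A n"] vn that unfolding C_def by fastforce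
    qed
    let ?c = "bp A n"
    define h where "h = (\<lambda>t. if t \<le> ?c then f t else g t)"
    have le: "bp A (Suc i) \<le> ?c" if "i < n" for i using bp_le[OF v, of "Suc i" n] that n by simp
    have "?c \<notin> supt f" unfolding f(2) using le by fastforce
    then have fc: "f ?c = ?c" by (rule homeo_plus_fixed[OF f(1)])
    have gc: "g ?c = ?c" by (rule homeo_plus_fixed[OF g(1)]) (simp add: g(2))
    have hh: "homeo_plus h" unfolding h_def by (rule homeo_plus_glue[OF f(1) g(1) fc gc])
    have hf: "h r = f r" if "i < n" "r \<in> cell A i" for i r using le[OF that(1)] that(2) unfolding h_def by simp
    have hg: "h r = g r" if "r \<in> cell A n" for r using that unfolding h_def by simp
    have Ch: "C h i" if "i < Suc n" for i
    proof (cases "i = n")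
      case True
      have "mk A n \<in> cell A n" "im A n \<in> cell A n" using vn by auto
      then show ?thesis using g(3) hg unfolding True C_def by presburger
    next
      case False
      then have i: "i < n" using that by simp
      have "mk A i \<in> cell A i" "im A i \<in> cell A i" using validD[OF v, of i] i n by auto
      then show ?thesis using f(3) i hf[OF i] unfolding C_def by (metis (no_types, lifting))
    qed
    have "supt h = (\<Union>i<Suc n. cell A i)"
    proof (intro equalityI subsetI)
      fix r assume r: "r \<in> supt h"
      show "r \<in> (\<Union>i<Suc n. cell A i)"
      proof (cases "r \<le> ?c")
        case True
        then have "r \<in> supt f" using r unfolding supt_def h_def by simp
        then show ?thesis unfolding f(2) lessThan_Suc by blast
      next
        case False
        then have "r \<in> supt g" using r unfolding supt_def h_def by simp
        then show ?thesis unfolding g(2) lessThan_Suc by blast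
      qed
    next
      fix r assume "r \<in> (\<Union>i<Suc n. cell A i)"
      then consider i where "i < n" "r \<in> cell A i" | "r \<in> cell A n" unfolding lessThan_Suc by blast
      then show "r \<in> supt h"
      proof cases
        case 1
        then have "r \<in> supt f" unfolding f(2) by blast
        then show ?thesis using hf[OF 1] unfolding supt_def by simp
      next
        case 2
        then have "r \<in> supt g" unfolding g(2) .
        then show ?thesis using hg[OF 2] unfolding supt_def by simp
      qed
    qed
    then show ?case using hh Ch by blast
  qed
  from this[OF order_refl] obtain f where "homeo_plus f" "supt f = (\<Union>i<nb A. cell A i)" "\<forall>i<nb A. C f i" by blast
  then have "has_frame (f, mk A ` {..<nb A}) A" unfolding has_frame_def C_def using v by simp
  then show ?thesis ..
qed

section \<open>Realizing functions that satisfy (!)\<close>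

text \<open>Equality of frames up to junk values at large indices; the core of an enlarged frame
  recovers the original in this sense.\<close>

definition agree :: "frame \<Rightarrow> frame \<Rightarrow> bool" where
  "agree A B \<longleftrightarrow> nb A = nb B \<and> (\<forall>i\<le>nb A. bp A i = bp B i) \<and> (\<forall>i<nb A. mk A i = mk B i \<and> im A i = im B i)"

lemma valid_agree: "valid B" if "agree A B" "valid A"
  using that unfolding agree_def valid_def by (metis Suc_leI less_imp_le)

lemma has_frame_agree: assumes "agree A B" "has_frame f A" shows "has_frame f B"
proof -
  have nb: "nb A = nb B" and i: "\<And>i. i < nb A \<Longrightarrow> bp A i = bp B i \<and> bp A (Suc i) = bp B (Suc i) \<and> mk A i = mk B i \<and> im A i = im B i"
    using assms(1) unfolding agree_def by auto
  have "(\<Union>i<nb A. cell A i) = (\<Union>i<nb B. cell B i)" "mk A ` {..<nb A} = mk B ` {..<nb B}"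
    unfolding nb[symmetric] using i by auto
  then show ?thesis using assms(2) i valid_agree[OF assms(1)] unfolding has_frame_def nb[symmetric] by auto
qed

text \<open>A standard pair together with its oscillation.  Functions with at most two orbitals need not
  occur as the larger element of a nested pair in the construction.\<close>

inductive frame_rel :: "frame \<Rightarrow> frame \<Rightarrow> int \<Rightarrow> bool" where
  ll: "hi A \<le> lo B \<Longrightarrow> frame_rel A B 0"
| sq: "feet_disjoint A B \<Longrightarrow> sq A B \<Longrightarrow> 2 < nb B \<Longrightarrow> agree (core B) C \<Longrightarrow> frame_rel C A n \<Longrightarrow> frame_rel A B (n + 1)"

text \<open>The increment by 1 in the nested rule of \<open>frame_rel\<close> is the rotation
  identity.\<close>

lemma frame_rel_std_pair:
  "frame_rel A B n \<Longrightarrow> has_frame f A \<Longrightarrow> has_frame g B \<Longrightarrow> std_pair f g \<and> osc f g = n"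
proof (induction arbitrary: f g rule: frame_rel.induct)
  case (ll A B)
  note v = has_frameD(1)[OF ll(2)] has_frameD(1)[OF ll(3)]
  have "fast {f, g}" using fast_iff[OF ll(2,3) ll_ne[OF ll]] ll_feet_disjoint[OF v ll(1)] by simp
  then have "std_pair f g" using std_ll_iff[OF ll(2,3)] ll(1) by (intro std_pair.ll) simp_all
  then show ?case using osc_frame_osc[OF ll(2,3)] frame_osc_ll[OF v ll(1)] by simp
next
  case (sq A B C n)
  note f = sq(7) and g = sq(8)
  obtain h where h: "has_frame h (core B)" "circ g h" using circ_large[OF g sq(3)] by blast
  have IH: "std_pair h f" "osc h f = n" using sq.IH[OF has_frame_agree[OF sq(4) h(1)] f] by auto
  have "fast {f, g}" using fast_iff[OF f g sq_ne[OF sq(2) f g]] sq(1) by simp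
  moreover have "std_sq f g" using std_sq_iff[OF f g] sq(2) by simp
  ultimately have p: "std_pair f g" using std_pair.sq[OF _ _ h(2) IH(1)] by blast
  have r: "circ_frame B (core B)" unfolding circ_frame_def using sq(3) by simp
  then show ?case using p frame_osc_rotate[OF p f g sq(2) r] osc_frame_osc[OF f g] osc_frame_osc[OF h(1) f] IH(2) by simp
qed

section \<open>Images of frames under increasing maps\<close>

definition frame_map :: "(real \<Rightarrow> real) \<Rightarrow> frame \<Rightarrow> frame" where
  "frame_map \<phi> A = Frame (nb A) (\<lambda>i. \<phi> (bp A i)) (\<lambda>i. \<phi> (mk A i)) (\<lambda>i. \<phi> (im A i))"

lemma frame_map_sel [simp]: "nb (frame_map \<phi> A) = nb A" "bp (frame_map \<phi> A) i = \<phi> (bp A i)"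
  "mk (frame_map \<phi> A) i = \<phi> (mk A i)" "im (frame_map \<phi> A) i = \<phi> (im A i)"
  unfolding frame_map_def by auto

lemma core_frame_map: "core (frame_map \<phi> A) = frame_map \<phi> (core A)"
  unfolding core_def frame_map_def by simp

lemma frame_pts_frame_map: "frame_pts (frame_map \<phi> A) = \<phi> ` frame_pts A"
  unfolding frame_pts_def by (simp add: image_Un image_image)

lemma valid_frame_map: "valid (frame_map \<phi> A)" if "strict_mono \<phi>" "valid A"
  using that unfolding valid_def by (simp add: strict_mono_less)

lemma feet_disjointI:
  assumes "\<And>i j. i < nb A \<Longrightarrow> j < nb B \<Longrightarrow> mk A i \<le> bp B j \<or> mk B j \<le> bp A i"
    "\<And>i j. i < nb A \<Longrightarrow> j < nb B \<Longrightarrow> bp A (Suc i) \<le> im B j \<or> bp B (Suc j) \<le> im A i"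
    "\<And>i j. i < nb A \<Longrightarrow> j < nb B \<Longrightarrow> mk A i \<le> im B j \<or> bp B (Suc j) \<le> bp A i"
    "\<And>i j. i < nb A \<Longrightarrow> j < nb B \<Longrightarrow> mk B j \<le> im A i \<or> bp A (Suc i) \<le> bp B j"
  shows "feet_disjoint A B"
  unfolding feet_disjoint_def
proof (intro allI impI)
  fix i j assume ij: "i < nb A" "j < nb B"
  show "foot A i \<inter> foot B j = {}"
    using assms[OF ij] unfolding foot_def by auto
qed

text \<open>All conditions in \<open>frame_rel\<close> are comparisons between points of frames,
  once disjointness of feet is written as inequalities.\<close>

lemma frame_rel_frame_map: "frame_rel A B n \<Longrightarrow> strict_mono \<phi> \<Longrightarrow> valid A \<Longrightarrow> valid B \<Longrightarrow> frame_rel (frame_map \<phi> A) (frame_map \<phi> B) n"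
proof (induction rule: frame_rel.induct)
  case (ll A B)
  then show ?case by (intro frame_rel.ll) (simp add: strict_mono_less_eq)
next
  case (sq A B C n)
  note mono = strict_mono_less_eq[OF sq(7)] strict_mono_less[OF sq(7)]
  have "feet_disjoint (frame_map \<phi> A) (frame_map \<phi> B)"
    by (rule feet_disjointI; unfold frame_map_sel mono; rule feet_disjointD[OF sq(1) sq(8,9)]; assumption)
  moreover have "sq (frame_map \<phi> A) (frame_map \<phi> B)" using sq(2) unfolding sq_def by (simp add: mono)
  moreover have "agree (core (frame_map \<phi> B)) (frame_map \<phi> C)" using sq(4) unfolding core_frame_map agree_def by simp
  moreover have "frame_rel (frame_map \<phi> C) (frame_map \<phi> A) n"
    using sq.IH[OF sq(7) valid_agree[OF sq(4) valid_core[OF sq(9,3)]] sq(8)] .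
  ultimately show ?case using frame_rel.sq[of "frame_map \<phi> A" "frame_map \<phi> B" "frame_map \<phi> C" n] sq(3) by simp
qed

text \<open>Supplies a point just left of \<open>x\<close>, from which a foot ending at
  \<open>x\<close> can start without touching a given finite set.\<close>

lemma gap_left: "\<exists>t<x. y < t \<and> (\<forall>p\<in>P. p < x \<longrightarrow> p < t)" if "finite P" "y < x" for x y :: real
  using that
proof (induction P)
  case empty
  then show ?case using dense[of y x] by auto
next
  case (insert p P)
  then obtain t where t: "t < x" "y < t" "\<forall>p\<in>P. p < x \<longrightarrow> p < t" by auto
  show ?case
  proof (cases "p < x")
    case True
    then obtain t' where "max t p < t'" "t' < x" using dense[of "max t p" x] t by auto
    then show ?thesis using t by (intro exI[of _ t']) auto
  next
    case False
    then show ?thesis using t by (intro exI[of _ t]) auto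
  qed
qed

lemma gap_right: "\<exists>t>x. t < y \<and> (\<forall>p\<in>P. x < p \<longrightarrow> t < p)" if P: "finite P" "x < y" for x y :: real
proof -
  obtain t where t: "t < - x" "- y < t" "\<forall>p\<in>uminus ` P. p < - x \<longrightarrow> p < t"
    using gap_left[of "uminus ` P" "- y" "- x"] P by auto
  then show ?thesis by (intro exI[of _ "- t"]) force
qed

text \<open>The frames share no points because \<open>enlarge\<close> requires the ends of the least
  frame not to be points of the others; the enlarged frame satisfies the same condition, so the
  induction can go on.\<close>

definition config :: "nat \<Rightarrow> (nat \<Rightarrow> nat \<Rightarrow> int) \<Rightarrow> (nat \<Rightarrow> frame) \<Rightarrow> bool" where
  "config n G fs \<longleftrightarrow> (\<forall>i<n. valid (fs i) \<and> frame_pts (fs i) \<subseteq> {0<..<1})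
     \<and> (\<forall>i j. i < j \<and> j < n \<longrightarrow> frame_rel (fs i) (fs j) (G i j) \<and> frame_pts (fs i) \<inter> frame_pts (fs j) = {})"

lemma config_singleton: assumes "n \<le> 1" shows "\<exists>fs. config n G fs"
proof -
  have "config n G (\<lambda>_. Frame 1 (\<lambda>i. if i = 0 then 1/5 else 4/5) (\<lambda>_. 2/5) (\<lambda>_. 3/5))"
    unfolding config_def valid_def frame_pts_def using assms by auto
  then show ?thesis by blast
qed

text \<open>The two summands are shrunk into the left and the right half of the interval, so that
  all pairs across are separated and have oscillation 0.\<close>

lemma config_split:
  assumes k: "k \<le> n" and fs: "config k G fs" and gs: "config (n - k) (\<lambda>i j. G (i + k) (j + k)) gs"
    and zero: "\<And>i j. i < k \<Longrightarrow> k \<le> j \<Longrightarrow> j < n \<Longrightarrow> G i j = 0"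
  shows "\<exists>hs. config n G hs"
proof -
  let ?l = "\<lambda>x::real. x / 2" and ?r = "\<lambda>x::real. (x + 1) / 2"
  have mono: "strict_mono ?l" "strict_mono ?r" by (auto simp: strict_mono_def)
  define hs where "hs = (\<lambda>i. if i < k then frame_map ?l (fs i) else frame_map ?r (gs (i - k)))"
  have F: "valid (fs i)" "frame_pts (fs i) \<subseteq> {0<..<1}" if "i < k" for i using fs that unfolding config_def by auto
  have G: "valid (gs i)" "frame_pts (gs i) \<subseteq> {0<..<1}" if "i < n - k" for i using gs that unfolding config_def by auto
  have FF: "frame_rel (fs i) (fs j) (G i j)" "frame_pts (fs i) \<inter> frame_pts (fs j) = {}" if "i < j" "j < k" for i j
    using fs that unfolding config_def by auto
  have GG: "frame_rel (gs i) (gs j) (G (i + k) (j + k))" "frame_pts (gs i) \<inter> frame_pts (gs j) = {}" if "i < j" "j < n - k" for i j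
    using gs that unfolding config_def by auto
  have hsl: "frame_pts (hs i) \<subseteq> {0<..<1/2}" if "i < k" for i
    using F(2)[OF that] that unfolding hs_def by (auto simp: frame_pts_frame_map subset_iff)
  have hsr: "frame_pts (hs i) \<subseteq> {1/2<..<1}" if "k \<le> i" "i < n" for i
    using G(2)[of "i - k"] that unfolding hs_def by (auto simp: frame_pts_frame_map subset_iff)
  have v: "valid (hs i)" if "i < n" for i
    using F(1)[of i] G(1)[of "i - k"] valid_frame_map[OF mono(1)] valid_frame_map[OF mono(2)] that unfolding hs_def by auto
  have injl: "inj ?l" and injr: "inj ?r" by (auto simp: inj_on_def)
  have "frame_rel (hs i) (hs j) (G i j) \<and> frame_pts (hs i) \<inter> frame_pts (hs j) = {}" if ij: "i < j" "j < n" for i j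
  proof -
    consider "j < k" | "i < k" "k \<le> j" | "k \<le> i" using ij by linarith
    then show ?thesis
    proof cases
      case 1
      then show ?thesis using frame_rel_frame_map[OF FF(1)[OF ij(1) 1] mono(1)] F(1) FF(2)[OF ij(1) 1] ij 
        unfolding hs_def by (simp add: frame_pts_frame_map image_Int[OF injl, symmetric])
    next
      case 2
      have h: "hi (hs i) \<in> frame_pts (hs i)" "lo (hs j) \<in> frame_pts (hs j)" unfolding frame_pts_def by auto
      have "hi (hs i) \<in> {0<..<1/2}" "lo (hs j) \<in> {1/2<..<1}" using h hsl[OF 2(1)] hsr[OF 2(2) ij(2)] by blast+
      then have "hi (hs i) \<le> lo (hs j)" by auto
      then have "frame_rel (hs i) (hs j) 0" by (rule frame_rel.ll)
      moreover have "frame_pts (hs i) \<inter> frame_pts (hs j) = {}"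
      proof -
        have "{0<..<1/2} \<inter> {1/2<..<1::real} = {}" by auto
        then show ?thesis using hsl[OF 2(1)] hsr[OF 2(2) ij(2)] by blast
      qed
      ultimately show ?thesis using zero[OF 2 ij(2)] by simp
    next
      case 3
      then have a: "i - k < j - k" "j - k < n - k" "i - k < n - k" "k \<le> j" using ij by auto
      have "frame_rel (frame_map ?r (gs (i - k))) (frame_map ?r (gs (j - k))) (G i j)"
        using frame_rel_frame_map[OF GG(1)[OF a(1,2)] mono(2) G(1)[OF a(3)] G(1)[OF a(2)]] 3 a by simp
      then show ?thesis using GG(2)[OF a(1,2)] 3 a
        unfolding hs_def by (simp add: frame_pts_frame_map image_Int[OF injr, symmetric])
    qed
  qed
  moreover have "frame_pts (hs i) \<subseteq> {0<..<1}" if "i < n" for i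
  proof -
    have "{0<..<1/2} \<subseteq> {0<..<1::real}" "{1/2<..<1} \<subseteq> {0<..<1::real}" by auto
    then show ?thesis using hsl[of i] hsr[of i] that by (cases "i < k") auto
  qed
  ultimately show ?thesis unfolding config_def using v by blast
qed

text \<open>Inverse of rotation: a frame is enlarged by one bump at either end, whose feet are so
  small that they avoid a given finite set of points and whose outer feet enclose all of it.\<close>

lemma enlarge:
  assumes X: "valid X" "frame_pts X \<subseteq> {0<..<1}" and P: "finite P" "P \<subseteq> {0<..<1}" "lo X \<notin> P" "hi X \<notin> P"
  shows "\<exists>E. valid E \<and> frame_pts E \<subseteq> {0<..<1} \<and> agree (core E) X \<and> 2 < nb E \<and> frame_pts E \<inter> P \<subseteq> frame_pts X
    \<and> (\<forall>Y. valid Y \<longrightarrow> frame_pts Y \<subseteq> P \<longrightarrow> feet_disjoint Y X \<longrightarrow> feet_disjoint Y E \<and> sq Y E)"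
proof -
  let ?n = "nb X"
  have n: "0 < ?n" using X(1) unfolding valid_def by simp
  have XP: "finite (frame_pts X)" unfolding frame_pts_def by simp
  have bX: "bp X i \<in> frame_pts X" if "i \<le> ?n" for i using that unfolding frame_pts_def by auto
  have mX: "mk X i \<in> frame_pts X" "im X i \<in> frame_pts X" if "i < ?n" for i using that unfolding frame_pts_def by auto
  let ?Q = "P \<union> frame_pts X"
  have Q: "finite ?Q" "\<And>p. p \<in> ?Q \<Longrightarrow> 0 < p \<and> p < 1" using P X XP by auto
  have lX: "0 < lo X" "lo X < 1" "0 < hi X" "hi X < 1" using Q(2) bX by auto
  \<comment> \<open>\<open>x0 < s0\<close> are left of all given points and \<open>tn < xn\<close>
    right of them, so the two outer feet avoid and enclose everything.\<close>
  obtain s0 where s0: "0 < s0" "s0 < 1" "\<forall>p\<in>?Q. 0 < p \<longrightarrow> s0 < p" using gap_right[OF Q(1), of 0 1] by auto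
  obtain x0 where x0: "0 < x0" "x0 < s0" using dense[OF s0(1)] by auto
  obtain tn where tn: "tn < 1" "0 < tn" "\<forall>p\<in>?Q. p < 1 \<longrightarrow> p < tn" using gap_left[OF Q(1), of 0 1] by auto
  obtain xn where xn: "tn < xn" "xn < 1" using dense[OF tn(1)] by auto
  have s0Q: "s0 < p" and tnQ: "p < tn" if "p \<in> ?Q" for p using s0(3) tn(3) Q(2) that by auto
  \<comment> \<open>\<open>t0\<close> and \<open>sn\<close> are so close to the ends of
    \<open>X\<close> that the thin inner feet contain no given point.\<close>
  obtain t0 where t0: "t0 < lo X" "s0 < t0" "\<forall>p\<in>?Q. p < lo X \<longrightarrow> p < t0" 
    using gap_left[OF Q(1), of s0 "lo X"] s0Q bX by auto
  obtain sn where sn: "hi X < sn" "sn < tn" "\<forall>p\<in>?Q. hi X < p \<longrightarrow> sn < p" 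
    using gap_right[OF Q(1), of "hi X" tn] tnQ bX by auto
  define E where "E = Frame (?n + 2)
     (\<lambda>i. if i = 0 then x0 else if i \<le> ?n + 1 then bp X (i - 1) else xn)
     (\<lambda>i. if i = 0 then s0 else if i \<le> ?n then mk X (i - 1) else sn)
     (\<lambda>i. if i = 0 then t0 else if i \<le> ?n then im X (i - 1) else tn)"
  have nbE: "nb E = ?n + 2" and E0: "bp E 0 = x0" "mk E 0 = s0" "im E 0 = t0" "bp E (Suc 0) = lo X"
    and En: "bp E (Suc ?n) = hi X" "mk E (Suc ?n) = sn" "im E (Suc ?n) = tn" "bp E (Suc (Suc ?n)) = xn"
    and Ei: "\<And>i. i \<le> ?n \<Longrightarrow> bp E (Suc i) = bp X i" "\<And>i. i < ?n \<Longrightarrow> mk E (Suc i) = mk X i" "\<And>i. i < ?n \<Longrightarrow> im E (Suc i) = im X i"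
    unfolding E_def by auto
  have idx: "i = 0 \<or> i = Suc ?n \<or> (\<exists>i'<?n. i = Suc i')" if "i < nb E" for i
    using that unfolding nbE by (cases i) auto
  have vE: "valid E"
    unfolding valid_def
  proof (intro conjI allI impI)
    show "0 < nb E" by (simp add: nbE)
    fix i assume "i < nb E"
    then have "bp E i < mk E i \<and> mk E i < im E i \<and> im E i < bp E (Suc i)"
      using idx[of i] E0 En Ei validD[OF X(1)] x0 s0 t0 sn tn xn by auto
    then show "bp E i < mk E i" "mk E i < im E i" "im E i < bp E (Suc i)" by auto
  qed
  have ptsE: "frame_pts E \<subseteq> frame_pts X \<union> {x0, s0, t0, sn, tn, xn}"
  proof -
    have "bp E i \<in> frame_pts X \<union> {x0, s0, t0, sn, tn, xn}" if "i \<le> nb E" for i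
      using that bX unfolding E_def by auto
    moreover have "mk E i \<in> frame_pts X \<union> {x0, s0, t0, sn, tn, xn}" "im E i \<in> frame_pts X \<union> {x0, s0, t0, sn, tn, xn}" if "i < nb E" for i
      using that mX unfolding E_def by auto
    ultimately show ?thesis unfolding frame_pts_def[of E] by blast
  qed
  have "frame_pts E \<subseteq> {0<..<1}"
    using ptsE X(2) x0 s0(1,2) t0(1,2) sn(1,2) tn(1,2) xn lX by fastforce
  moreover have "agree (core E) X" unfolding agree_def using nbE Ei by simp
  moreover have "x0 \<notin> P" "s0 \<notin> P" "t0 \<notin> P" "sn \<notin> P" "tn \<notin> P" "xn \<notin> P"
    using s0Q[of x0] s0Q[of s0] t0 sn tnQ[of tn] tnQ[of xn] x0 xn by fastforce+
  then have "frame_pts E \<inter> P \<subseteq> frame_pts X" using ptsE by blast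
  moreover have "feet_disjoint Y E \<and> sq Y E" if Y: "valid Y" "frame_pts Y \<subseteq> P" "feet_disjoint Y X" for Y
  proof
    have bY: "bp Y i \<in> P" if "i \<le> nb Y" for i using that Y(2) unfolding frame_pts_def by auto
    have mY: "mk Y i \<in> P" "im Y i \<in> P" if "i < nb Y" for i using that Y(2) unfolding frame_pts_def by auto
    have low: "s0 < p" "p < tn" if "p \<in> P" for p using s0Q tnQ that by auto
    \<comment> \<open>The ends of \<open>X\<close> are not in \<open>P\<close>, so each point of
      \<open>Y\<close> lies strictly on one side of a thin foot including the adjacent end of
      \<open>X\<close>.\<close>
    have t0P: "p < t0 \<or> lo X < p" if "p \<in> P" for p using t0(3) that P(3) by (metis UnI1 linorder_neqE)
    have snP: "sn < p \<or> p < hi X" if "p \<in> P" for p using sn(3) that P(4) by (metis UnI1 linorder_neqE)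
    show "sq Y E" unfolding sq_def nbE using low bY E0 En x0 xn by fastforce
    show "feet_disjoint Y E"
    proof (rule feet_disjointI)
      fix i j assume ij: "i < nb Y" "j < nb E"
      note vy = validD[OF Y(1) ij(1)]
      have inP: "bp Y i \<in> P" "bp Y (Suc i) \<in> P" "mk Y i \<in> P" "im Y i \<in> P" using bY mY ij by auto
      note dX = feet_disjointD[OF Y(3,1) X(1) ij(1)]
      have n1: "?n - 1 < ?n" "Suc (?n - 1) = ?n" using n by auto
      note d0 = dX[OF n] and dn = dX[OF n1(1), unfolded n1(2)]
      note v0 = validD[OF X(1) n] and vn = validD[OF X(1) n1(1), unfolded n1(2)]
      consider "j = 0" | "j = Suc ?n" | j' where "j' < ?n" "j = Suc j'" using idx[OF ij(2)] by blast
      then have "(mk Y i \<le> bp E j \<or> mk E j \<le> bp Y i) \<and> (bp Y (Suc i) \<le> im E j \<or> bp E (Suc j) \<le> im Y i)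
        \<and> (mk Y i \<le> im E j \<or> bp E (Suc j) \<le> bp Y i) \<and> (mk E j \<le> im Y i \<or> bp Y (Suc i) \<le> bp E j)"
      proof cases
        case 1
        have "s0 < bp Y i" "s0 < im Y i" using low inP by auto
        \<comment> \<open>A foot of \<open>Y\<close> meeting the thin foot before
          \<open>lo X\<close> has no end in it, so it would reach beyond \<open>lo X\<close> and
          meet the first left foot of \<open>X\<close>.\<close>
        moreover have "bp Y (Suc i) \<le> t0 \<or> lo X \<le> im Y i"
          using t0P[OF inP(2)] t0P[OF inP(4)] d0(4) vy v0 by linarith
        moreover have "mk Y i \<le> t0 \<or> lo X \<le> bp Y i"
          using t0P[OF inP(3)] t0P[OF inP(1)] d0(1) vy v0 by linarith
        ultimately show ?thesis unfolding 1 E0 by linarith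
      next
        case 2
        have "bp Y (Suc i) < tn" "mk Y i < tn" using low inP by auto
        \<comment> \<open>The mirror image at \<open>hi X\<close>, where the last right foot of
          \<open>X\<close> is the obstacle.\<close>
        moreover have "mk Y i \<le> hi X \<or> sn \<le> bp Y i"
          using snP[OF inP(3)] snP[OF inP(1)] dn(3) vy vn by linarith
        moreover have "sn \<le> im Y i \<or> bp Y (Suc i) \<le> hi X"
          using snP[OF inP(4)] snP[OF inP(2)] dn(2) vy vn by linarith
        ultimately show ?thesis unfolding 2 En by linarith
      next
        case 3
        then show ?thesis using dX[OF 3(1)] Ei 3 by simp
      qed
      then show "mk Y i \<le> bp E j \<or> mk E j \<le> bp Y i" "bp Y (Suc i) \<le> im E j \<or> bp E (Suc j) \<le> im Y i"
        "mk Y i \<le> im E j \<or> bp E (Suc j) \<le> bp Y i" "mk E j \<le> im Y i \<or> bp Y (Suc i) \<le> bp E j" by auto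
    qed
  qed
  ultimately show ?thesis using vE nbE n by (intro exI[of _ E]) auto
qed

text \<open>The least frame is enlarged and becomes the greatest. Its core still agrees with the old
  frame, so the nested rule of \<open>frame_rel\<close> turns each pair (fs 0, Y) into (Y, E) with
  value raised by one; other pairs are only renumbered.\<close>

lemma config_unrotate:
  assumes n: "1 < n" and R: "config n R fs"
    and G: "\<And>i. i < n - 1 \<Longrightarrow> G i (n - 1) = R 0 (Suc i) + 1" "\<And>i j. i < j \<Longrightarrow> j < n - 1 \<Longrightarrow> G i j = R (Suc i) (Suc j)"
  shows "\<exists>gs. config n G gs"
proof -
  let ?X = "fs 0" and ?N = "n - 1"
  have F: "valid (fs i)" "frame_pts (fs i) \<subseteq> {0<..<1}" if "i < n" for i using R that unfolding config_def by auto
  have FF: "frame_rel (fs i) (fs j) (R i j)" "frame_pts (fs i) \<inter> frame_pts (fs j) = {}" if "i < j" "j < n" for i j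
    using R that unfolding config_def by auto
  define P where "P = (\<Union>i\<in>{1..<n}. frame_pts (fs i))"
  have "finite P" unfolding P_def frame_pts_def by simp
  moreover have "P \<subseteq> {0<..<1}" unfolding P_def using F(2) by (intro UN_least) simp
  ultimately have P: "finite P" "P \<subseteq> {0<..<1}" .
  have "frame_pts ?X \<inter> frame_pts (fs i) = {}" if "i \<in> {1..<n}" for i using FF(2)[of 0 i] that by simp
  then have XP: "frame_pts ?X \<inter> P = {}" unfolding P_def by blast
  have "lo ?X \<in> frame_pts ?X" "hi ?X \<in> frame_pts ?X" unfolding frame_pts_def by auto
  then have lh: "lo ?X \<notin> P" "hi ?X \<notin> P" using XP by blast+
  obtain E where E: "valid E" "frame_pts E \<subseteq> {0<..<1}" "agree (core E) ?X" "2 < nb E" "frame_pts E \<inter> P \<subseteq> frame_pts ?X"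
    "\<And>Y. valid Y \<Longrightarrow> frame_pts Y \<subseteq> P \<Longrightarrow> feet_disjoint Y ?X \<Longrightarrow> feet_disjoint Y E \<and> sq Y E"
    using enlarge[OF F(1)[of 0] F(2)[of 0] P lh] n by auto
  have PE: "frame_pts E \<inter> P = {}" using E(5) XP by blast
  define gs where "gs = (\<lambda>i. if i < ?N then fs (Suc i) else E)"
  have "frame_rel (gs i) (gs j) (G i j) \<and> frame_pts (gs i) \<inter> frame_pts (gs j) = {}" if ij: "i < j" "j < n" for i j
  proof (cases "j < ?N")
    case True
    then show ?thesis using FF[of "Suc i" "Suc j"] G(2)[OF ij(1) True] ij unfolding gs_def by simp
  next
    case False
    then have j: "j = ?N" "i < ?N" using ij by auto
    let ?Y = "fs (Suc i)"
    have si: "Suc i < n" "Suc i \<in> {1..<n}" using j by auto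
    have YP: "frame_pts ?Y \<subseteq> P" unfolding P_def using si(2) by blast
    note rel = FF(1)[of 0 "Suc i", OF _ si(1), simplified]
    have "feet_disjoint ?X ?Y" using rel ll_feet_disjoint[OF F(1)[of 0] F(1)[OF si(1)]] n by cases auto
    then have "feet_disjoint ?Y ?X" unfolding feet_disjoint_def by blast
    then have "feet_disjoint ?Y E" "sq ?Y E" using E(6)[OF F(1)[OF si(1)] YP] by auto
    then have "frame_rel ?Y E (R 0 (Suc i) + 1)" using E(4,3) rel by (rule frame_rel.sq)
    moreover have "frame_pts ?Y \<inter> frame_pts E = {}" using YP PE by blast
    ultimately show ?thesis using G(1)[OF j(2)] j unfolding gs_def by simp
  qed
  moreover have "valid (gs i) \<and> frame_pts (gs i) \<subseteq> {0<..<1}" if "i < n" for i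
    using F[of "Suc i"] E(1,2) unfolding gs_def by auto
  ultimately have "config n G gs" unfolding config_def by blast
  then show ?thesis by blast
qed

section \<open>Existence of configurations by induction on base and total value\<close>

definition weight :: "nat \<Rightarrow> (nat \<Rightarrow> nat \<Rightarrow> int) \<Rightarrow> int" where
  "weight n G = (\<Sum>j<n. \<Sum>i<j. G i j)"

text \<open>The last column becomes the first row, each of its N values lowered by 1; the other
  values are only renumbered.\<close>

lemma weight_rotate:
  "weight (Suc N) (\<lambda>i j. if i = 0 then G (j - 1) N - 1 else G (i - 1) (j - 1)) = weight (Suc N) G - int N"
proof -
  let ?R = "\<lambda>i j. if i = 0 then G (j - 1) N - 1 else G (i - 1) (j - 1)"
  have "weight (Suc N) ?R = (\<Sum>j<N. \<Sum>i<Suc j. ?R i (Suc j))"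
    unfolding weight_def by (subst sum.lessThan_Suc_shift) simp
  also have "\<dots> = (\<Sum>j<N. (G j N - 1) + (\<Sum>i<j. G i j))"
    by (intro sum.cong refl) (subst sum.lessThan_Suc_shift, simp)
  also have "\<dots> = (\<Sum>j<N. G j N) - int N + (\<Sum>j<N. \<Sum>i<j. G i j)"
    by (simp add: sum.distrib sum_subtractf)
  finally show ?thesis unfolding weight_def by simp
qed

text \<open>The base splits after the last index \<open>m\<close> whose value with \<open>N\<close>
  is 0. For i < m, a nonzero value at (i, N) would by (!) force -1 at (i, m). For m < j < N the
  value at (j, N) is positive, and (!) forces 0 at (i, j) whenever i \<le> m.\<close>

lemma split_exists:
  fixes G :: "nat \<Rightarrow> nat \<Rightarrow> int"
  assumes nn: "\<And>i j. i < j \<Longrightarrow> j \<le> N \<Longrightarrow> 0 \<le> G i j"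
    and b: "\<And>i j k. i < j \<Longrightarrow> j < k \<Longrightarrow> k \<le> N \<Longrightarrow> bang (G i j) (G j k) (G i k)"
    and z: "i < N" "G i N = 0"
  shows "\<exists>k. 0 < k \<and> k \<le> N \<and> (\<forall>i j. i < k \<longrightarrow> k \<le> j \<longrightarrow> j \<le> N \<longrightarrow> G i j = 0)"
proof -
  define m where "m = Max {i. i < N \<and> G i N = 0}"
  have fin: "finite {i. i < N \<and> G i N = 0}" by simp
  have "m \<in> {i. i < N \<and> G i N = 0}" unfolding m_def by (rule Max_in[OF fin]) (use z in auto)
  then have m: "m < N" "G m N = 0" by auto
  have max: "G j N \<noteq> 0" if "m < j" "j < N" for j
  proof
    assume "G j N = 0"
    then have "j \<le> m" unfolding m_def using that(2) by (intro Max_ge[OF fin]) simp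
    then show False using that(1) by simp
  qed
  have last: "G i N = 0" if "i \<le> m" for i
  proof (rule ccontr)
    assume c: "G i N \<noteq> 0"
    then have im: "i < m" using that m by (cases "i = m") auto
    then have "bang (G i m) 0 (G i N)" using b[of i m N] m by simp
    then show False using c nn[of i m] nn[of i N] im m unfolding bang_def by auto
  qed
  have "G i j = 0" if ij: "i < Suc m" "Suc m \<le> j" "j \<le> N" for i j
  proof (cases "j = N")
    case True then show ?thesis using last ij by simp
  next
    case False
    then have "bang (G i j) (G j N) 0" using b[of i j N] last[of i] ij by simp
    then show ?thesis using max[of j] nn[of j N] ij False unfolding bang_def by auto
  qed
  then show ?thesis using m by (intro exI[of _ "Suc m"]) auto
qed

text \<open>Lexicographic induction on the size of the base and the total value. If some value with
  the last element is 0, the function splits into two with smaller bases. Otherwise these values are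
  at least 1, so the rotation is nonnegative, and its total is smaller by N > 0.\<close>

lemma config_exists:
  assumes "\<And>i j. i < j \<Longrightarrow> j < n \<Longrightarrow> 0 \<le> G i j"
    and "\<And>i j k. i < j \<Longrightarrow> j < k \<Longrightarrow> k < n \<Longrightarrow> bang (G i j) (G j k) (G i k)"
  shows "\<exists>fs. config n G fs"
  using assms
proof (induction n arbitrary: G rule: less_induct)
  case (less n)
  note outer = less.IH
  show ?case
    using less.prems
  proof (induction "nat (weight n G)" arbitrary: G rule: less_induct)
    case less
    note nn = less.prems(1) and b = less.prems(2)
    show ?case
    proof (cases "n \<le> 1")
      case True
      then show ?thesis by (rule config_singleton)
    next
      case False
      then obtain N where N: "n = Suc N" "0 < N" by (cases n) auto
      show ?thesis
      proof (cases "\<exists>i<N. G i N = 0")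
        case True
        then obtain i where i: "i < N" "G i N = 0" by blast
        have "\<exists>k. 0 < k \<and> k \<le> N \<and> (\<forall>i j. i < k \<longrightarrow> k \<le> j \<longrightarrow> j \<le> N \<longrightarrow> G i j = 0)"
          by (rule split_exists[of N G, OF _ _ i]) (use nn b N in auto)
        then obtain k where k: "0 < k" "k \<le> N" "\<And>i j. i < k \<Longrightarrow> k \<le> j \<Longrightarrow> j \<le> N \<Longrightarrow> G i j = 0" by blast
        have kn: "k < n" "n - k < n" using k N by auto
        obtain fs where fs: "config k G fs" using outer[OF kn(1), of G] nn b kn by fastforce
        have "\<exists>gs. config (n - k) (\<lambda>i j. G (i + k) (j + k)) gs"
          by (rule outer[OF kn(2)]) (use nn b in auto)
        then obtain gs where "config (n - k) (\<lambda>i j. G (i + k) (j + k)) gs" by blast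
        then show ?thesis using config_split[OF _ fs, of n] k(3) kn(1) N(1) by simp
      next
        case False
        then have pos: "1 \<le> G i N" if "i < N" for i using nn[of i N] that N by fastforce
        define R where "R = (\<lambda>i j. if i = 0 then G (j - 1) N - 1 else G (i - 1) (j - 1))"
        have R0: "0 \<le> R i j" if "i < j" "j < n" for i j
        proof (cases "i = 0")
          case True
          have "j - 1 < N" using that N by linarith
          then show ?thesis using pos[of "j - 1"] True unfolding R_def by simp
        next
          case False
          then show ?thesis using nn[of "i - 1" "j - 1"] that unfolding R_def by auto
        qed
        have Rb: "bang (R i j) (R j k) (R i k)" if "i < j" "j < k" "k < n" for i j k
        proof (cases "i = 0")
          case True
          have "bang (G (j - 1) (k - 1)) (G (k - 1) N) (G (j - 1) N)" using b[of "j - 1" "k - 1" N] that N by auto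
          then show ?thesis using bang_rotate that True unfolding R_def by simp
        next
          case False
          then show ?thesis using b[of "i - 1" "j - 1" "k - 1"] that unfolding R_def by auto
        qed
        have "weight n R = weight n G - int N" unfolding R_def N(1) by (rule weight_rotate)
        moreover have "0 \<le> weight n R" unfolding weight_def using R0 by (intro sum_nonneg) auto
        ultimately have "nat (weight n R) < nat (weight n G)" using N(2) by simp
        then obtain fs where "config n R fs" using less.hyps[of R] R0 Rb by blast
        then show ?thesis using config_unrotate[of n R fs G] N unfolding R_def by simp
      qed
    qed
  qed
qed

lemma bang_signature:
  fixes B :: "'a::linorder set"
  assumes fin: "finite B" and nn: "\<forall>a\<in>B. \<forall>b\<in>B. a < b \<longrightarrow> 0 \<le> F a b" and b: "bang_cond B (<) F"
  shows "\<exists>A\<in>\<S>. pf_equiv B (<) F A std_lt osc"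
proof -
  define n where "n = card B"
  define e where "e = (\<lambda>i. sorted_list_of_set B ! i)"
  have eB: "e i \<in> B" if "i < n" for i
    using nth_mem[of i "sorted_list_of_set B"] that fin unfolding e_def n_def by simp
  have mono: "e i < e j" if "i < j" "j < n" for i j
    using sorted_wrt_nth_less[OF strict_sorted_list_of_set[of B], of i j] that unfolding e_def n_def by simp
  have emono: "e i < e j \<longleftrightarrow> i < j" if "i < n" "j < n" for i j
    using mono[of i j] mono[of j i] that by (cases i j rule: linorder_cases) auto
  have "e ` {0..<n} = B"
  proof -
    have "set (sorted_list_of_set B) = e ` {0..<n}" 
      unfolding set_conv_nth e_def n_def by auto
    then show ?thesis using fin by simp
  qed
  moreover have "inj_on e {0..<n}" by (intro inj_onI) (metis atLeastLessThan_iff emono less_irrefl nat_neq_iff)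
  ultimately have e: "bij_betw e {0..<n} B" unfolding bij_betw_def by simp
  define G where "G = (\<lambda>i j. F (e i) (e j))"
  have "\<exists>fs. config n G fs"
  proof (rule config_exists)
    show "0 \<le> G i j" if "i < j" "j < n" for i j 
      using nn eB mono[OF that] that unfolding G_def by simp
    show "bang (G i j) (G j k) (G i k)" if "i < j" "j < k" "k < n" for i j k
      using b eB mono[of i j] mono[of j k] that unfolding bang_cond_def G_def by simp
  qed
  then obtain fs where fs: "config n G fs" by blast
  have "\<exists>f. has_frame f (fs i)" if "i < n" for i
  proof (rule has_frame_exists)
    show "valid (fs i)" using fs that unfolding config_def by simp
    have "frame_pts (fs i) \<subseteq> {0<..<1}" using fs that unfolding config_def by simp
    moreover have "bp (fs i) ` {..nb (fs i)} \<subseteq> frame_pts (fs i)" unfolding frame_pts_def by blast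
    moreover have "{0<..<1} \<subseteq> {0..1::real}" by auto
    ultimately show "bp (fs i) ` {..nb (fs i)} \<subseteq> {0..1}" by blast
  qed
  then obtain m where m: "\<And>i. i < n \<Longrightarrow> has_frame (m i) (fs i)" by metis
  have rel: "std_pair (m i) (m j) \<and> osc (m i) (m j) = G i j" if "i < j" "j < n" for i j
  proof (rule frame_rel_std_pair)
    show "frame_rel (fs i) (fs j) (G i j)" using fs that unfolding config_def by blast
  qed (use m that in auto)
  have std: "standard (m i)" if "i < n" for i using has_frame_standard[OF m[OF that]] .
  have lt: "std_lt (m i) (m j)" if "i < j" "j < n" for i j
    using rel[OF that] std_pair_lt unfolding std_lt_def by blast
  define A where "A = m ` {0..<n}"
  have eqG: "pf_equiv {0..<n} (<) G A std_lt osc"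
    by (rule pf_equivI[OF std A_def]) (use lt rel in auto)
  then obtain h where h: "bij_betw h {0..<n} A" "\<forall>i\<in>{0..<n}. \<forall>j\<in>{0..<n}. i < j \<longleftrightarrow> std_lt (h i) (h j)"
    "\<forall>i\<in>{0..<n}. \<forall>j\<in>{0..<n}. i < j \<longrightarrow> osc (h i) (h j) = G i j" unfolding pf_equiv_def by blast
  \<comment> \<open>Membership in \<open>std_sets\<close> asks for a standard pair wherever
    \<open>std_lt\<close> holds; by asymmetry it holds only in the order of the indices, where
    \<open>rel\<close> applies.\<close>
  have ltm: "i < j" if "i < n" "j < n" "std_lt (m i) (m j)" for i j
  proof (rule ccontr)
    assume "\<not> i < j"
    then have "std_lt (m j) (m i) \<or> i = j" using lt[of j i] that by (cases "i = j") auto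
    then show False using std_lt_asym[OF std std that(3)] that by auto
  qed
  have "A \<in> \<S>" unfolding std_sets_def
  proof (intro CollectI conjI ballI impI)
    show "finite A" unfolding A_def by simp
    show "standard f" if "f \<in> A" for f using that std unfolding A_def by auto
    show "std_lt f g \<or> std_lt g f" if fg: "f \<in> A" "g \<in> A" "f \<noteq> g" for f g
    proof -
      obtain i j where ij: "i < n" "j < n" "f = m i" "g = m j" using fg unfolding A_def by auto
      then have "i < j \<or> j < i" using fg(3) by (metis nat_neq_iff)
      then show ?thesis using lt ij by blast
    qed
    show "std_pair f g" if fg: "f \<in> A" "g \<in> A" "std_lt f g" for f g
    proof -
      obtain i j where ij: "i < n" "j < n" "f = m i" "g = m j" using fg unfolding A_def by auto
      then show ?thesis using rel[of i j] ltm[of i j] fg(3) by simp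
    qed
  qed
  moreover have "pf_equiv B (<) F A std_lt osc"
  proof -
    define e' where "e' = the_inv_into {0..<n} e"
    have e': "bij_betw e' B {0..<n}" unfolding e'_def by (rule bij_betw_the_inv_into[OF e])
    have ee: "e (e' a) = a" "e' a < n" if "a \<in> B" for a
      using f_the_inv_into_f_bij_betw[OF e] that bij_betwE[OF e'] unfolding e'_def by auto
    have bij: "bij_betw (h \<circ> e') B A" by (rule bij_betw_trans[OF e' h(1)])
    have "a < b \<longleftrightarrow> std_lt (h (e' a)) (h (e' b))" if "a \<in> B" "b \<in> B" for a b
      using h(2) emono[of "e' a" "e' b"] ee[OF that(1)] ee[OF that(2)] by auto
    moreover have "osc (h (e' a)) (h (e' b)) = F a b" if "a \<in> B" "b \<in> B" "a < b" for a b
      using h(3) emono[of "e' a" "e' b"] ee[OF that(1)] ee[OF that(2)] that(3) unfolding G_def by auto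
    ultimately show ?thesis unfolding pf_equiv_def using bij by (intro exI[of _ "h \<circ> e'"]) auto
  qed
  ultimately show ?thesis by blast
qed

theorem theorem5p8:
  fixes B :: "'a::linorder set" and F :: "'a \<Rightarrow> 'a \<Rightarrow> int"
  shows "(finite B \<and> (\<forall>a\<in>B. \<forall>b\<in>B. a < b \<longrightarrow> 0 \<le> F a b) \<longrightarrow>
            (bang_cond B (<) F \<longleftrightarrow> (\<exists>A\<in>\<S>. pf_equiv B (<) F A std_lt osc)))
       \<and> (\<forall>A\<in>\<S>. \<forall>n G. pf_equiv {0..<n} (<) G A std_lt osc \<longrightarrow>
            (\<forall>A'. set_rotation A A' \<longrightarrow>
               pf_equiv {0..<fst (pf_rot (n, G))} (<) (snd (pf_rot (n, G))) A' std_lt osc))"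
  using bang_signature[of B F] signature_bang[of _ B F] signature_rotation by blast

end
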